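(* For any constants $C\ge 2$ (an integer) and $\epsilon>0$, there is a polynomial-time $\left(\frac{2C-1}{C}+\epsilon\right)$-approximation algorithm for instances of \textsc{L-Sided Pricing} satisfying $\mu_v\le C$ for all $v\in L$ (no bound is imposed on the capacities of vertices in $R$). That is, the algorithm outputs a feasible solution of revenue at least $\left(\frac{2C-1}{C}+\epsilon\right)^{-1}$ times the optimum revenue.
   Context: An instance of \textsc{L-Sided Pricing} consists of a finite bipartite graph $G=(L\cup R,E)$ (parallel edges allowed, no loops; each edge $e=uv$ with $u\in L$, $v\in R$ is a customer interested in the bundle $\{u,v\}$), a capacity $\mu_w\in\mathbb Z_{\ge 0}\cup\{\infty\}$ for every vertex $w\in L\cup R$, and a rational budget $b_e\ge 0$ for every edge $e\in E$. A feasible solution is a pair $(p,F)$ where $p:L\cup R\to\mathbb R_{\ge0}$ satisfies $p(v)=0$ for every $v\in R$, and $F\subseteq E$ satisfies (i) $p(u)+p(v)\le b_e$ for every $e=uv\in F$ and (ii) every vertex $w$ is incident to at most $\mu_w$ edges of $F$. The revenue of $(p,F)$ is $\sum_{e=uv\in F}(p(u)+p(v))$, to be maximized. *)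

theory Defs
  imports
    Complex_Main
    "HOL-Library.Extended_Nat"
    "HOL-Library.Log_Nat"
    "HOL-Computational_Algebra.Polynomial"
begin

section \<open>L-Sided Pricing\<close>

text \<open>Edges are abstract names carrying their two end points, so that parallel edges are allowed.\<close>

record ('v, 'e) pricing =
  lefts :: "'v set"
  rights :: "'v set"
  edges :: "'e set"
  left_end :: "'e \<Rightarrow> 'v"
  right_end :: "'e \<Rightarrow> 'v"
  capacity :: "'v \<Rightarrow> enat"
  budget :: "'e \<Rightarrow> rat"

definition pricing_instance :: "('v, 'e) pricing \<Rightarrow> bool" where
  "pricing_instance I \<longleftrightarrow>
     finite (lefts I) \<and> finite (rights I) \<and> lefts I \<inter> rights I = {} \<and> finite (edges I) \<and>
     (\<forall>e\<in>edges I. left_end I e \<in> lefts I \<and> right_end I e \<in> rights I \<and> 0 \<le> budget I e)"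

definition feasible :: "('v, 'e) pricing \<Rightarrow> ('v \<Rightarrow> real) \<Rightarrow> 'e set \<Rightarrow> bool" where
  "feasible I p F \<longleftrightarrow>
     (\<forall>w\<in>lefts I \<union> rights I. 0 \<le> p w) \<and> (\<forall>v\<in>rights I. p v = 0) \<and>
     F \<subseteq> edges I \<and>
     (\<forall>e\<in>F. p (left_end I e) + p (right_end I e) \<le> of_rat (budget I e)) \<and>
     (\<forall>w\<in>lefts I \<union> rights I.
        enat (card {e\<in>F. left_end I e = w \<or> right_end I e = w}) \<le> capacity I w)"

definition revenue :: "('v, 'e) pricing \<Rightarrow> ('v \<Rightarrow> real) \<Rightarrow> 'e set \<Rightarrow> real" where
  "revenue I p F = (\<Sum>e\<in>F. p (left_end I e) + p (right_end I e))"

definition opt_revenue :: "('v, 'e) pricing \<Rightarrow> real" where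
  "opt_revenue I = Sup {revenue I p F | p F. feasible I p F}"

text \<open>The supremum is over a nonempty set that is bounded above.\<close>

lemma feasible_empty:
  assumes "pricing_instance I"
  shows "feasible I (\<lambda>_. 0) {}"
  by (simp add: feasible_def zero_enat_def [symmetric])

lemma revenue_le_opt_revenue:
  assumes I: "pricing_instance I" and pF: "feasible I p F"
  shows "revenue I p F \<le> opt_revenue I"
proof -
  have "revenue I q H \<le> (\<Sum>e\<in>edges I. of_rat (budget I e))" if "feasible I q H" for q H
  proof -
    have H: "H \<subseteq> edges I" and le: "\<And>e. e \<in> H \<Longrightarrow>
        q (left_end I e) + q (right_end I e) \<le> of_rat (budget I e)"
      using that by (auto simp: feasible_def)
    have "revenue I q H \<le> (\<Sum>e\<in>H. of_rat (budget I e))"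
      unfolding revenue_def by (rule sum_mono) (rule le)
    also have "\<dots> \<le> (\<Sum>e\<in>edges I. of_rat (budget I e))"
      using I H by (intro sum_mono2) (auto simp: pricing_instance_def)
    finally show ?thesis .
  qed
  then have "bdd_above {revenue I p F | p F. feasible I p F}"
    by (intro bdd_aboveI) auto
  then show ?thesis
    unfolding opt_revenue_def using pF by (intro cSup_upper) auto
qed

section \<open>Algorithms and their running time\<close>

text \<open>
  Algorithms are programs of a deterministic first-order functional language whose values are
  binary trees with integer leaves, under the logarithmic cost criterion of random access machines:
  an arithmetic operation is charged the bit lengths of its operands, and every other evaluation
  step is charged one unit. Trees are never copied or compared as a whole, so a program is
  implemented on a random access machine by a heap of integers and pairs of pointers and a stack of
  bounded frames, of total size linear in the size of the input and the running time (for a fixed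
  program).
  Hence polynomial time in this model is polynomial time on Turing machines.
\<close>

datatype val = Num int | Pr val val

definition bit_size :: "int \<Rightarrow> nat" where
  "bit_size i = 1 + floorlog 2 (nat \<bar>i\<bar>)"

primrec val_size :: "val \<Rightarrow> nat" where
  "val_size (Num i) = bit_size i"
| "val_size (Pr x y) = 1 + val_size x + val_size y"

datatype binop = Add | Sub | Mul | Div | Leq

primrec binop_sem :: "binop \<Rightarrow> int \<Rightarrow> int \<Rightarrow> int" where
  "binop_sem Add i j = i + j"
| "binop_sem Sub i j = i - j"
| "binop_sem Mul i j = i * j"
| "binop_sem Div i j = i div j"
| "binop_sem Leq i j = (if i \<le> j then 1 else 0)"

text \<open>
  Variables are de Bruijn indices into the environment, which is a list of values. The expression
  \<open>Call f as\<close> invokes the \<open>f\<close>-th function of the program, whose body is evaluated in the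
  environment consisting of the values of the arguments only. In conditionals \<open>Num 0\<close> is false and
  every other integer is true.
\<close>

datatype expr =
    Var nat
  | Lit int
  | Op binop expr expr
  | MkPair expr expr
  | First expr
  | Second expr
  | IsPair expr
  | IfE expr expr expr
  | LetE expr expr
  | Call nat "expr list"

type_synonym program = "expr list"

text \<open>
  \<open>eval P \<rho> a x t\<close> means that \<open>a\<close> evaluates to \<open>x\<close> in environment \<open>\<rho>\<close> at cost \<open>t\<close>. There is no
  such \<open>x\<close> if the evaluation diverges or gets stuck (for instance by projecting from an integer).
\<close>

inductive eval :: "program \<Rightarrow> val list \<Rightarrow> expr \<Rightarrow> val \<Rightarrow> nat \<Rightarrow> bool"
  and eval_list :: "program \<Rightarrow> val list \<Rightarrow> expr list \<Rightarrow> val list \<Rightarrow> nat \<Rightarrow> bool"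
  for P :: program
where
  eval_Var: "n < length \<rho> \<Longrightarrow> eval P \<rho> (Var n) (\<rho> ! n) 1"
| eval_Lit: "eval P \<rho> (Lit i) (Num i) 1"
| eval_Op: "eval P \<rho> a (Num i) s \<Longrightarrow> eval P \<rho> b (Num j) t \<Longrightarrow>
    eval P \<rho> (Op f a b) (Num (binop_sem f i j)) (1 + s + t + bit_size i + bit_size j)"
| eval_MkPair: "eval P \<rho> a x s \<Longrightarrow> eval P \<rho> b y t \<Longrightarrow>
    eval P \<rho> (MkPair a b) (Pr x y) (1 + s + t)"
| eval_First: "eval P \<rho> a (Pr x y) t \<Longrightarrow> eval P \<rho> (First a) x (1 + t)"
| eval_Second: "eval P \<rho> a (Pr x y) t \<Longrightarrow> eval P \<rho> (Second a) y (1 + t)"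
| eval_IsPair_Pr: "eval P \<rho> a (Pr x y) t \<Longrightarrow> eval P \<rho> (IsPair a) (Num 1) (1 + t)"
| eval_IsPair_Num: "eval P \<rho> a (Num i) t \<Longrightarrow> eval P \<rho> (IsPair a) (Num 0) (1 + t)"
| eval_IfE_true: "eval P \<rho> a (Num i) s \<Longrightarrow> i \<noteq> 0 \<Longrightarrow> eval P \<rho> b x t \<Longrightarrow>
    eval P \<rho> (IfE a b c) x (1 + s + t)"
| eval_IfE_false: "eval P \<rho> a (Num 0) s \<Longrightarrow> eval P \<rho> c x t \<Longrightarrow>
    eval P \<rho> (IfE a b c) x (1 + s + t)"
| eval_LetE: "eval P \<rho> a x s \<Longrightarrow> eval P (x # \<rho>) b y t \<Longrightarrow>
    eval P \<rho> (LetE a b) y (1 + s + t)"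
| eval_Call: "f < length P \<Longrightarrow> eval_list P \<rho> as xs s \<Longrightarrow> eval P xs (P ! f) y t \<Longrightarrow>
    eval P \<rho> (Call f as) y (1 + s + t)"
| eval_list_Nil: "eval_list P \<rho> [] [] 0"
| eval_list_Cons: "eval P \<rho> a x s \<Longrightarrow> eval_list P \<rho> as xs t \<Longrightarrow>
    eval_list P \<rho> (a # as) (x # xs) (s + t)"

inductive_cases eval_VarE: "eval P \<rho> (Var n) x t"
inductive_cases eval_LitE: "eval P \<rho> (Lit i) x t"
inductive_cases eval_OpE: "eval P \<rho> (Op f a b) x t"
inductive_cases eval_MkPairE: "eval P \<rho> (MkPair a b) x t"
inductive_cases eval_FirstE: "eval P \<rho> (First a) x t"
inductive_cases eval_SecondE: "eval P \<rho> (Second a) x t"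
inductive_cases eval_IsPairE: "eval P \<rho> (IsPair a) x t"
inductive_cases eval_IfEE: "eval P \<rho> (IfE a b c) x t"
inductive_cases eval_LetEE: "eval P \<rho> (LetE a b) x t"
inductive_cases eval_CallE: "eval P \<rho> (Call f as) x t"
inductive_cases eval_list_NilE: "eval_list P \<rho> [] xs t"
inductive_cases eval_list_ConsE: "eval_list P \<rho> (a # as) xs t"

lemma eval_deterministic:
  "eval P \<rho> a x t \<Longrightarrow> eval P \<rho> a x' t' \<Longrightarrow> x' = x \<and> t' = t"
  "eval_list P \<rho> as xs t \<Longrightarrow> eval_list P \<rho> as xs' t' \<Longrightarrow> xs' = xs \<and> t' = t"
proof (induction arbitrary: x' t' and xs' t' rule: eval_eval_list.inducts)
  case eval_Var
  then show ?case by (auto elim: eval_VarE)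
next
  case eval_Lit
  then show ?case by (auto elim: eval_LitE)
next
  case eval_Op
  from eval_Op.prems show ?case by (rule eval_OpE) (auto dest!: eval_Op.IH(2,4))
next
  case eval_MkPair
  from eval_MkPair.prems show ?case by (rule eval_MkPairE) (auto dest!: eval_MkPair.IH(2,4))
next
  case eval_First
  from eval_First.prems show ?case by (rule eval_FirstE) (auto dest!: eval_First.IH(2))
next
  case eval_Second
  from eval_Second.prems show ?case by (rule eval_SecondE) (auto dest!: eval_Second.IH(2))
next
  case eval_IsPair_Pr
  from eval_IsPair_Pr.prems show ?case by (rule eval_IsPairE) (auto dest!: eval_IsPair_Pr.IH(2))
next
  case eval_IsPair_Num
  from eval_IsPair_Num.prems show ?case by (rule eval_IsPairE) (auto dest!: eval_IsPair_Num.IH(2))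
next
  case eval_IfE_true
  from eval_IfE_true.prems show ?case by (rule eval_IfEE) (auto dest!: eval_IfE_true.IH(2,4) simp: eval_IfE_true.hyps)
next
  case eval_IfE_false
  from eval_IfE_false.prems show ?case by (rule eval_IfEE) (auto dest!: eval_IfE_false.IH(2,4))
next
  case eval_LetE
  from eval_LetE.prems show ?case by (rule eval_LetEE) (auto dest!: eval_LetE.IH(2,4))
next
  case eval_Call
  from eval_Call.prems show ?case by (rule eval_CallE) (auto dest!: eval_Call.IH(3,5))
next
  case eval_list_Nil
  then show ?case by (auto elim: eval_list_NilE)
next
  case eval_list_Cons
  from eval_list_Cons.prems show ?case by (rule eval_list_ConsE) (auto dest!: eval_list_Cons.IH(2,4))
qed

definition computes_in :: "program \<Rightarrow> val \<Rightarrow> val \<Rightarrow> nat \<Rightarrow> bool" where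
  "computes_in P x y t \<longleftrightarrow> eval P [x] (Call 0 [Var 0]) y t"

section \<open>Encodings\<close>

primrec enc_list :: "val list \<Rightarrow> val" where
  "enc_list [] = Num 0"
| "enc_list (x # xs) = Pr x (enc_list xs)"

definition enc_nat :: "nat \<Rightarrow> val" where
  "enc_nat n = Num (int n)"

definition enc_rat :: "rat \<Rightarrow> val" where
  "enc_rat r = (case quotient_of r of (n, d) \<Rightarrow> Pr (Num n) (Num d))"

definition enc_capacity :: "enat \<Rightarrow> val" where
  "enc_capacity c = (case c of enat n \<Rightarrow> enc_nat n | \<infinity> \<Rightarrow> Num (- 1))"

definition enc_vertex :: "(nat, nat) pricing \<Rightarrow> nat \<Rightarrow> val" where
  "enc_vertex I w = Pr (enc_nat w) (enc_capacity (capacity I w))"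

definition enc_edge :: "(nat, nat) pricing \<Rightarrow> nat \<Rightarrow> val" where
  "enc_edge I e =
     Pr (enc_nat e) (Pr (enc_nat (left_end I e)) (Pr (enc_nat (right_end I e)) (enc_rat (budget I e))))"

text \<open>
  For the purpose of computation, vertices and edges are named by arbitrary natural numbers. Finite
  sets are represented by lists without repetitions, in any order.
\<close>

definition encodes_instance :: "val \<Rightarrow> (nat, nat) pricing \<Rightarrow> bool" where
  "encodes_instance x I \<longleftrightarrow>
     (\<exists>us vs es. distinct us \<and> set us = lefts I \<and> distinct vs \<and> set vs = rights I \<and>
        distinct es \<and> set es = edges I \<and>
        x = Pr (enc_list (map (enc_vertex I) us))
              (Pr (enc_list (map (enc_vertex I) vs)) (enc_list (map (enc_edge I) es))))"

definition encodes_solution ::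
    "val \<Rightarrow> (nat, nat) pricing \<Rightarrow> (nat \<Rightarrow> real) \<Rightarrow> nat set \<Rightarrow> bool" where
  "encodes_solution y I p F \<longleftrightarrow>
     (\<exists>ws es r. distinct ws \<and> set ws = lefts I \<union> rights I \<and> distinct es \<and> set es = F \<and>
        (\<forall>w\<in>lefts I \<union> rights I. p w = of_rat (r w)) \<and>
        y = Pr (enc_list (map (\<lambda>w. Pr (enc_nat w) (enc_rat (r w))) ws))
              (enc_list (map enc_nat es)))"

definition polytime_approximation ::
    "program \<Rightarrow> real \<Rightarrow> (nat, nat) pricing set \<Rightarrow> bool" where
  "polytime_approximation P \<alpha> \<I> \<longleftrightarrow>
     (\<exists>q :: nat poly. \<forall>I\<in>\<I>. \<forall>x. encodes_instance x I \<longrightarrow>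
        (\<exists>y t p F. computes_in P x y t \<and> t \<le> poly q (val_size x) \<and>
           encodes_solution y I p F \<and> feasible I p F \<and>
           revenue I p F \<ge> inverse \<alpha> * opt_revenue I))"

end

theory Submission
  imports Defs
begin

text \<open>
  The algorithm is a local search over sets \<open>F\<close> of sold edges that respect the capacities; a move adds
  and removes at most \<open>K\<close> edges, where \<open>K\<close> depends on \<open>C\<close> and \<open>\<epsilon>\<close> only. Budgets are first scaled
  and rounded down to integers of polynomial size, which bounds the number of moves and costs a
  factor arbitrarily close to \<open>1\<close>.

  Let \<open>F\<close> be a local optimum and \<open>G\<close> any solution. Match the edges of \<open>G\<close> with edges of \<open>F\<close> at the same
  right vertex, maximally. For a set \<open>A\<close> of left vertices, exchanging the edges of \<open>F\<close> at \<open>A\<close> for those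
  of \<open>G\<close>, and evicting the partners of the new edges, is feasible. It loses the revenue of \<open>F\<close> at \<open>A\<close>
  and the prices of the evicted edges outside \<open>A\<close>. With singletons \<open>A\<close> this gives ratio 2. To save
  \<open>1 / C\<close>, label the at most \<open>C\<close> edges of \<open>G\<close> at every left vertex by numbers below \<open>C\<close>. The edges with
  a fixed label form a functional graph of bounded in-degree on the left vertices. It has a family of
  sets of bounded size that covers every vertex \<open>\<rho> + 1\<close> times such that every arc leaves at most one
  of the sets. So the evicted edges of one label out of \<open>C\<close> are almost free.
\<close>

section \<open>The local optimum analysis\<close>

text \<open>The obstacle is that the edges of \<open>G\<close> at one left vertex may evict edges at
  up to \<open>C\<close> other left vertices, and the graph of all these arcs can expand, so that
  many arcs leave every bounded set. One label keeps one arc per vertex, and the set of points that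
  run into a common root within \<rho> steps is left only through the root. Hence one label at a
  time is made cheap, and averaging over the labels gives the ratio 1 + (C - 1) / C + 1 / (C (\<rho>
  + 1)). Right capacities are unbounded, so feasibility there rests on the maximality of the
  matching: no right vertex exceeds the larger of its degrees in \<open>F\<close> and
  \<open>G\<close>. A budget may be huge although its edge can never be sold, so the scale is set by
  the largest budget \<open>B\<close> of an edge that can be sold alone. Then \<open>B\<close> is a
  lower bound on the optimum. With \<open>n\<close> edges and \<open>B\<close> scaled to
  \<open>c n\<close> units, rounding costs at most \<open>n\<close> units, a fraction 1 / c of the
  optimum.\<close>

definition at_left :: "('v, 'e) pricing \<Rightarrow> 'e set \<Rightarrow> 'v \<Rightarrow> 'e set" where
  "at_left I F u = {e\<in>F. left_end I e = u}"

definition within_capacity :: "('v, 'e) pricing \<Rightarrow> 'e set \<Rightarrow> bool" where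
  "within_capacity I F \<longleftrightarrow> F \<subseteq> edges I \<and>
     (\<forall>w\<in>lefts I \<union> rights I.
        enat (card {e\<in>F. left_end I e = w \<or> right_end I e = w}) \<le> capacity I w)"

text \<open>
  For a fixed set of sold edges the best price of \<open>u\<close> is the least budget among its sold edges, so a
  solution is represented by its edge set alone. A left vertex without sold edges contributes \<open>0\<close>
  whatever the value of \<open>Min\<close> on the empty set.
\<close>

definition gain :: "('v, 'e) pricing \<Rightarrow> ('e \<Rightarrow> real) \<Rightarrow> 'e set \<Rightarrow> real" where
  "gain I b F = (\<Sum>u\<in>lefts I. real (card (at_left I F u)) * Min (b ` at_left I F u))"

subsection \<open>Bounded pieces of a functional graph\<close>

text \<open>If \<open>r\<close> lies on no cycle, the count is 0 or 1 and tells whether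
  \<open>x\<close> reaches \<open>r\<close> within \<rho> steps; the sets built from it generalise
  backward balls around \<open>r\<close>.\<close>

definition orbit_visits :: "nat \<Rightarrow> ('a \<Rightarrow> 'a) \<Rightarrow> 'a \<Rightarrow> 'a \<Rightarrow> nat" where
  "orbit_visits \<rho> s r x = card {k. k \<le> \<rho> \<and> (s ^^ k) x = r}"

text \<open>Passing to \<open>s x\<close> drops the first orbit point and appends a new last one.
  The count can fall only if the dropped point is the root itself, and then by one.\<close>

lemma orbit_visits_step: "orbit_visits \<rho> s r x \<le> orbit_visits \<rho> s r (s x) + (if x = r then 1 else 0)"
proof -
  let ?S = "{k. k \<le> \<rho> \<and> (s ^^ k) (s x) = r}"
  have fin: "finite ?S" by (rule finite_subset[of _ "{..\<rho>}"]) auto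
  have "{k. k \<le> \<rho> \<and> (s ^^ k) x = r} \<subseteq> (if x = r then {0} else {}) \<union> Suc ` ?S"
  proof
    fix k assume k: "k \<in> {k. k \<le> \<rho> \<and> (s ^^ k) x = r}"
    show "k \<in> (if x = r then {0} else {}) \<union> Suc ` ?S"
    proof (cases k)
      case 0
      then show ?thesis using k by auto
    next
      case (Suc j)
      then have "j \<in> ?S" using k by (simp add: funpow_swap1)
      then show ?thesis using Suc by blast
    qed
  qed
  then have "orbit_visits \<rho> s r x \<le> card ((if x = r then {0} else {}) \<union> Suc ` ?S)"
    unfolding orbit_visits_def by (intro card_mono) (auto simp: fin)
  also have "\<dots> \<le> card (if x = r then {0::nat} else {}) + card (Suc ` ?S)"
    by (rule card_Un_le)
  also have "\<dots> = orbit_visits \<rho> s r (s x) + (if x = r then 1 else 0)"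
    by (auto simp: orbit_visits_def card_image)
  finally show ?thesis .
qed

lemma sum_orbit_visits:
  assumes "finite V" "s ` V \<subseteq> V" "x \<in> V"
  shows "(\<Sum>r\<in>V. orbit_visits \<rho> s r x) = Suc \<rho>"
proof -
  have orb: "(s ^^ k) x \<in> V" for k
    using assms by (induction k) auto
  have "(\<Sum>r\<in>V. orbit_visits \<rho> s r x) = card (\<Union>r\<in>V. {k. k \<le> \<rho> \<and> (s ^^ k) x = r})"
    unfolding orbit_visits_def using assms(1) by (subst card_UN_disjoint) auto
  also have "(\<Union>r\<in>V. {k. k \<le> \<rho> \<and> (s ^^ k) x = r}) = {..\<rho>}"
    using orb by auto
  finally show ?thesis by simp
qed

text \<open>
  Counting visits with multiplicity is what makes the levels cover every vertex equally often even
  when the orbit runs into a short cycle.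
\<close>

definition orbit_level :: "'a set \<Rightarrow> nat \<Rightarrow> ('a \<Rightarrow> 'a) \<Rightarrow> 'a \<times> nat \<Rightarrow> 'a set" where
  "orbit_level V \<rho> s = (\<lambda>(r, m). {x\<in>V. m \<le> orbit_visits \<rho> s r x})"

lemma orbit_visits_le: "orbit_visits \<rho> s r x \<le> Suc \<rho>"
proof -
  have "orbit_visits \<rho> s r x \<le> card {..\<rho>}"
    unfolding orbit_visits_def by (rule card_mono) auto
  then show ?thesis by simp
qed

text \<open>For a root \<open>r\<close>, the thresholds from 1 up to the count of visits to
  \<open>r\<close> are those whose level contains \<open>x\<close>, and each of the \<rho> + 1 orbit
  points is counted at one root.\<close>

lemma card_levels_containing:
  assumes "finite V" "s ` V \<subseteq> V" "x \<in> V"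
  shows "card {j\<in>V \<times> {1..Suc \<rho>}. x \<in> orbit_level V \<rho> s j} = Suc \<rho>"
proof -
  have "{j\<in>V \<times> {1..Suc \<rho>}. x \<in> orbit_level V \<rho> s j} = (SIGMA r:V. {1..orbit_visits \<rho> s r x})"
    using assms(3) by (auto simp: orbit_level_def intro: order_trans[OF _ orbit_visits_le[of \<rho> s _ x, unfolded One_nat_def]])
  then show ?thesis
    using assms by (simp add: card_SigmaI sum_orbit_visits)
qed

text \<open>A cut arc needs a threshold above the count of \<open>s x\<close> but not above that of
  \<open>x\<close>. Only the root \<open>x\<close> allows this, with a difference of one, so root
  and threshold are both forced.\<close>

lemma card_levels_cut:
  assumes "s ` V \<subseteq> V" "x \<in> V"
  shows "card {j\<in>V \<times> {1..Suc \<rho>}. x \<in> orbit_level V \<rho> s j \<and> s x \<notin> orbit_level V \<rho> s j} \<le> 1"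
proof -
  have "{j\<in>V \<times> {1..Suc \<rho>}. x \<in> orbit_level V \<rho> s j \<and> s x \<notin> orbit_level V \<rho> s j}
      \<subseteq> {(x, orbit_visits \<rho> s x x)}"
  proof
    fix j assume "j \<in> {j\<in>V \<times> {1..Suc \<rho>}. x \<in> orbit_level V \<rho> s j \<and> s x \<notin> orbit_level V \<rho> s j}"
    moreover obtain r m where j: "j = (r, m)" by (cases j)
    ultimately have "m \<le> orbit_visits \<rho> s r x" "\<not> m \<le> orbit_visits \<rho> s r (s x)"
      using assms by (auto simp: orbit_level_def)
    then have "r = x \<and> m = orbit_visits \<rho> s x x"
      using orbit_visits_step[of \<rho> s r x] by (auto split: if_splits)
    then show "j \<in> {(x, orbit_visits \<rho> s x x)}" using j by simp
  qed
  from card_mono[OF _ this] show ?thesis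
    by simp
qed

lemma card_funpow_fibre:
  assumes "finite V" "s ` V \<subseteq> V" and d: "\<And>y. y \<in> V \<Longrightarrow> card {x\<in>V. s x = y} \<le> d" and "r \<in> V"
  shows "card {x\<in>V. (s ^^ k) x = r} \<le> d ^ k"
  using assms(4)
proof (induction k arbitrary: r)
  case 0
  then have "{x\<in>V. (s ^^ 0) x = r} = {r}" by auto
  then show ?case by simp
next
  case (Suc k)
  have "{x\<in>V. (s ^^ Suc k) x = r} = (\<Union>y\<in>{y\<in>V. (s ^^ k) y = r}. {x\<in>V. s x = y})"
    using assms(2) by (auto simp: funpow_swap1)
  also have "card \<dots> \<le> (\<Sum>y\<in>{y\<in>V. (s ^^ k) y = r}. card {x\<in>V. s x = y})"
    using assms(1) by (intro card_UN_le) auto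
  also have "\<dots> \<le> (\<Sum>y\<in>{y\<in>V. (s ^^ k) y = r}. d)"
    by (intro sum_mono) (use d in auto)
  also have "\<dots> \<le> d ^ k * d"
    using Suc by simp
  finally show ?case by (simp add: mult.commute)
qed

text \<open>Thresholds start at 1, so every member reaches the root within \<rho> steps. The bound
  does not depend on \<open>V\<close>, which keeps the moves bounded.\<close>

lemma card_orbit_level:
  assumes "finite V" "s ` V \<subseteq> V" "\<And>y. y \<in> V \<Longrightarrow> card {x\<in>V. s x = y} \<le> d" "1 \<le> d"
    and j: "j \<in> V \<times> {1..Suc \<rho>}"
  shows "card (orbit_level V \<rho> s j) \<le> Suc \<rho> * d ^ \<rho>"
proof -
  obtain r m where rm: "j = (r, m)" "r \<in> V" "1 \<le> m" using j by auto
  have "orbit_level V \<rho> s j \<subseteq> (\<Union>k\<le>\<rho>. {x\<in>V. (s ^^ k) x = r})"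
  proof
    fix x assume "x \<in> orbit_level V \<rho> s j"
    then have "x \<in> V" and "1 \<le> orbit_visits \<rho> s r x"
      using rm by (auto simp: orbit_level_def)
    then have "x \<in> V" "card {k. k \<le> \<rho> \<and> (s ^^ k) x = r} \<noteq> 0"
      unfolding orbit_visits_def by linarith+
    moreover from this(2) have "{k. k \<le> \<rho> \<and> (s ^^ k) x = r} \<noteq> {}"
      by (metis card.empty)
    ultimately show "x \<in> (\<Union>k\<le>\<rho>. {x\<in>V. (s ^^ k) x = r})"
      by blast
  qed
  then have "card (orbit_level V \<rho> s j) \<le> card (\<Union>k\<le>\<rho>. {x\<in>V. (s ^^ k) x = r})"
    using assms(1) by (intro card_mono) auto
  also have "\<dots> \<le> (\<Sum>k\<le>\<rho>. card {x\<in>V. (s ^^ k) x = r})"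
    by (intro card_UN_le) auto
  also have "\<dots> \<le> (\<Sum>k\<le>\<rho>. d ^ \<rho>)"
  proof (rule sum_mono)
    fix k assume "k \<in> {..\<rho>}"
    then show "card {x\<in>V. (s ^^ k) x = r} \<le> d ^ \<rho>"
      using card_funpow_fibre[OF assms(1-3) rm(2), of k] power_increasing[of k \<rho> d] assms(4)
      by auto
  qed
  finally show ?thesis by simp
qed

subsection \<open>Local optima\<close>

text \<open>Any two elements may be paired, so an injection of the smaller set into the larger one
  is maximal; it is inverted if \<open>B\<close> is the smaller one.\<close>

lemma exists_maximal_matching:
  assumes "finite A" "finite B"
  shows "\<exists>D \<pi>. D \<subseteq> A \<and> inj_on \<pi> D \<and> \<pi> ` D \<subseteq> B \<and> (D = A \<or> \<pi> ` D = B)"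
proof (cases "card A \<le> card B")
  case True
  then obtain \<pi> where "\<pi> ` A \<subseteq> B" "inj_on \<pi> A"
    using card_le_inj[OF assms] by blast
  then show ?thesis by blast
next
  case False
  then obtain \<sigma> where \<sigma>: "\<sigma> ` B \<subseteq> A" "inj_on \<sigma> B"
    using card_le_inj[OF assms(2,1)] by auto
  have "inj_on (inv_into B \<sigma>) (\<sigma> ` B)"
    by (rule inj_on_inv_into) simp
  moreover have "inv_into B \<sigma> ` (\<sigma> ` B) = B"
    using \<sigma>(2) by (rule inv_into_image_cancel) simp
  ultimately show ?thesis
    using \<sigma>(1) by blast
qed

text \<open>Matchings chosen separately for each value of \<open>r\<close> glue to an injection,
  because partners share that value.\<close>

lemma exists_fibrewise_matching:
  assumes "finite F" "finite G"
  shows "\<exists>D \<pi>. D \<subseteq> G \<and> inj_on \<pi> D \<and> (\<forall>e\<in>D. \<pi> e \<in> F \<and> r (\<pi> e) = r e) \<and>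
    (\<forall>v. {e\<in>D. r e = v} = {e\<in>G. r e = v} \<or> \<pi> ` {e\<in>D. r e = v} = {e\<in>F. r e = v})"
proof -
  have "\<forall>v. \<exists>D \<pi>. D \<subseteq> {e\<in>G. r e = v} \<and> inj_on \<pi> D \<and> \<pi> ` D \<subseteq> {e\<in>F. r e = v} \<and>
      (D = {e\<in>G. r e = v} \<or> \<pi> ` D = {e\<in>F. r e = v})"
    using assms by (intro allI exists_maximal_matching) auto
  from choice[OF this] obtain D where
    "\<forall>v. \<exists>\<pi>. D v \<subseteq> {e\<in>G. r e = v} \<and> inj_on \<pi> (D v) \<and> \<pi> ` D v \<subseteq> {e\<in>F. r e = v} \<and>
      (D v = {e\<in>G. r e = v} \<or> \<pi> ` D v = {e\<in>F. r e = v})" ..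
  from choice[OF this] obtain \<pi> where
    "\<forall>v. D v \<subseteq> {e\<in>G. r e = v} \<and> inj_on (\<pi> v) (D v) \<and> \<pi> v ` D v \<subseteq> {e\<in>F. r e = v} \<and>
      (D v = {e\<in>G. r e = v} \<or> \<pi> v ` D v = {e\<in>F. r e = v})" ..
  then have D: "\<And>v. D v \<subseteq> {e\<in>G. r e = v}" and inj: "\<And>v. inj_on (\<pi> v) (D v)"
    and \<pi>: "\<And>v. \<pi> v ` D v \<subseteq> {e\<in>F. r e = v}"
    and max: "\<And>v. D v = {e\<in>G. r e = v} \<or> \<pi> v ` D v = {e\<in>F. r e = v}"
    by blast+
  define D' where "D' = {e\<in>G. e \<in> D (r e)}"
  define \<pi>' where "\<pi>' e = \<pi> (r e) e" for e
  have fib: "{e\<in>D'. r e = v} = D v" for v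
    using D[of v] by (auto simp: D'_def)
  have im: "\<pi>' ` D v = \<pi> v ` D v" for v
    using D[of v] by (intro image_cong) (auto simp: \<pi>'_def)
  have \<pi>': "\<pi>' e \<in> F \<and> r (\<pi>' e) = r e" if "e \<in> D'" for e
    using that \<pi>[of "r e"] by (auto simp: D'_def \<pi>'_def)
  have inj': "inj_on \<pi>' D'"
  proof (rule inj_onI)
    fix x y assume xy: "x \<in> D'" "y \<in> D'" "\<pi>' x = \<pi>' y"
    then have "r x = r y"
      using \<pi>' by metis
    then show "x = y"
      using xy inj[of "r x"] by (auto simp: D'_def \<pi>'_def dest: inj_onD)
  qed
  show ?thesis
  proof (intro exI conjI)
    show "D' \<subseteq> G"
      by (auto simp: D'_def)
    show "\<forall>e\<in>D'. \<pi>' e \<in> F \<and> r (\<pi>' e) = r e"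
      using \<pi>' by blast
    show "\<forall>v. {e\<in>D'. r e = v} = {e\<in>G. r e = v} \<or> \<pi>' ` {e\<in>D'. r e = v} = {e\<in>F. r e = v}"
      using max by (simp add: fib im)
  qed (rule inj')
qed

lemma sum_over_family:
  fixes f :: "'a \<Rightarrow> real"
  assumes "finite J" "finite V" "\<And>j. j \<in> J \<Longrightarrow> A j \<subseteq> V"
  shows "(\<Sum>j\<in>J. \<Sum>u\<in>A j. f u) = (\<Sum>u\<in>V. real (card {j\<in>J. u \<in> A j}) * f u)"
proof -
  have "(\<Sum>j\<in>J. \<Sum>u\<in>A j. f u) = (\<Sum>j\<in>J. \<Sum>u\<in>V. if u \<in> A j then f u else 0)"
    using assms by (intro sum.cong[OF refl]) (simp add: sum.inter_restrict[symmetric] Int_absorb1)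
  also have "\<dots> = (\<Sum>u\<in>V. \<Sum>j\<in>J. if u \<in> A j then f u else 0)"
    by (rule sum.swap)
  also have "\<dots> = (\<Sum>u\<in>V. real (card {j\<in>J. u \<in> A j}) * f u)"
    using assms(1) by (intro sum.cong[OF refl]) (simp add: sum.inter_filter[symmetric])
  finally show ?thesis .
qed

section \<open>Capacities and a single exchange\<close>

locale capacitated =
  fixes I :: "('v, 'e) pricing" and C :: nat
  assumes inst: "pricing_instance I" and cap_left: "\<forall>v\<in>lefts I. capacity I v \<le> enat C"
begin

lemma finite_edges: "F \<subseteq> edges I \<Longrightarrow> finite F"
  using inst by (auto simp: pricing_instance_def intro: finite_subset)

lemma finite_lefts: "finite (lefts I)"
  using inst by (auto simp: pricing_instance_def)

lemma left_end: "e \<in> edges I \<Longrightarrow> left_end I e \<in> lefts I"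
  and right_end: "e \<in> edges I \<Longrightarrow> right_end I e \<in> rights I"
  and disjoint: "w \<in> lefts I \<Longrightarrow> w \<notin> rights I"
  using inst by (auto simp: pricing_instance_def)

lemma incident_left:
  assumes "F \<subseteq> edges I" "w \<in> lefts I"
  shows "{e\<in>F. left_end I e = w \<or> right_end I e = w} = at_left I F w"
  using assms right_end disjoint by (auto simp: at_left_def)

lemma incident_right:
  assumes "F \<subseteq> edges I" "w \<in> rights I"
  shows "{e\<in>F. left_end I e = w \<or> right_end I e = w} = {e\<in>F. right_end I e = w}"
  using assms left_end disjoint by auto

lemma card_at_left:
  assumes "within_capacity I F" "u \<in> lefts I"
  shows "card (at_left I F u) \<le> C"
proof -
  have "F \<subseteq> edges I" "enat (card {e\<in>F. left_end I e = u \<or> right_end I e = u}) \<le> capacity I u"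
    using assms by (auto simp: within_capacity_def)
  then have "enat (card (at_left I F u)) \<le> capacity I u"
    using incident_left[of F u] assms(2) by simp
  also have "\<dots> \<le> enat C"
    using cap_left assms(2) by blast
  finally show ?thesis by simp
qed

lemma card_edges_at:
  assumes F: "within_capacity I F" and A: "A \<subseteq> lefts I"
  shows "card {e\<in>F. left_end I e \<in> A} \<le> card A * C"
proof -
  have fin: "finite A" using A finite_lefts finite_subset by blast
  have "{e\<in>F. left_end I e \<in> A} = (\<Union>u\<in>A. at_left I F u)"
    by (auto simp: at_left_def)
  also have "card \<dots> \<le> (\<Sum>u\<in>A. card (at_left I F u))"
    using fin by (rule card_UN_le)
  also have "\<dots> \<le> (\<Sum>u\<in>A. C)"
    using A by (intro sum_mono card_at_left F) auto
  finally show ?thesis by simp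
qed

end

text \<open>In the second alternative of \<open>maximal\<close> the right vertex has at least as
  many edges of \<open>G\<close> as of \<open>F\<close>, so an edge of \<open>G\<close> outside
  \<open>D\<close> may enter without evicting anything. \<open>F\<close> and \<open>G\<close> may
  overlap, and a common edge need not be its own partner.\<close>

locale exchange = capacitated +
  fixes F G :: "'b set" and D \<pi>
  assumes F: "within_capacity I F" and G: "within_capacity I G"
    and D: "D \<subseteq> G" and inj: "inj_on \<pi> D"
    and \<pi>: "\<And>e. e \<in> D \<Longrightarrow> \<pi> e \<in> F \<and> right_end I (\<pi> e) = right_end I e"
    and maximal: "\<And>v. {e\<in>D. right_end I e = v} = {e\<in>G. right_end I e = v} \<or>
      \<pi> ` {e\<in>D. right_end I e = v} = {e\<in>F. right_end I e = v}"
begin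

text \<open>
  Inside \<open>A\<close> the sold edges of \<open>F\<close> are replaced by those of \<open>G\<close>; an incoming edge \<open>e\<close> evicts \<open>\<pi> e\<close>
  from the right end point that they share.
\<close>

definition swap :: "'a set \<Rightarrow> 'b set" where
  "swap A = (F - {e\<in>F. left_end I e \<in> A} - \<pi> ` {e\<in>D. left_end I e \<in> A}) \<union> {e\<in>G. left_end I e \<in> A}"

lemma FG_edges: "F \<subseteq> edges I" "G \<subseteq> edges I"
  using F G by (auto simp: within_capacity_def)

lemma finite_FG: "finite F" "finite G" "finite D"
  using FG_edges finite_edges D finite_subset by blast+

text \<open>The factor 3 stands for the edges of \<open>F\<close> at \<open>A\<close>, the edges of
  \<open>G\<close> at \<open>A\<close>, and the evicted edges, which are no more than the incoming
  ones.\<close>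

lemma card_swap_diff:
  assumes "A \<subseteq> lefts I"
  shows "card ((F - swap A) \<union> (swap A - F)) \<le> 3 * (card A * C)"
proof -
  have "(F - swap A) \<union> (swap A - F) \<subseteq>
      {e\<in>F. left_end I e \<in> A} \<union> (\<pi> ` {e\<in>D. left_end I e \<in> A} \<union> {e\<in>G. left_end I e \<in> A})" (is "_ \<subseteq> ?X \<union> (?Y \<union> ?Z)")
    by (auto simp: swap_def)
  then have "card ((F - swap A) \<union> (swap A - F)) \<le> card (?X \<union> (?Y \<union> ?Z))"
    using finite_FG by (intro card_mono) auto
  also have "\<dots> \<le> card ?X + (card ?Y + card ?Z)"
    by (meson card_Un_le add_left_mono order_trans)
  also have "card ?Y \<le> card {e\<in>D. left_end I e \<in> A}"
    using finite_FG by (intro card_image_le) auto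
  also have "\<dots> \<le> card ?Z"
    using finite_FG D by (intro card_mono) auto
  finally show ?thesis
    using card_edges_at[OF F assms] card_edges_at[OF G assms] by linarith
qed

lemma at_left_swap_in: "u \<in> A \<Longrightarrow> at_left I (swap A) u = at_left I G u"
  by (auto simp: swap_def at_left_def)

lemma at_left_swap_out:
  "u \<notin> A \<Longrightarrow> at_left I (swap A) u = at_left I F u - \<pi> ` {e\<in>D. left_end I e \<in> A \<and> left_end I (\<pi> e) = u}"
  by (auto simp: swap_def at_left_def)

text \<open>If all edges of \<open>G\<close> at \<open>v\<close> are matched, each new edge evicts
  an old one. Otherwise every old edge is a partner; the survivors correspond to edges of
  \<open>D\<close> at \<open>v\<close> that stay out, and together with the newcomers these are
  distinct edges of \<open>G\<close>.\<close>

lemma card_right_swap: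
  "card {e\<in>swap A. right_end I e = v} \<le> max (card {e\<in>F. right_end I e = v}) (card {e\<in>G. right_end I e = v})"
proof -
  let ?Fv = "{e\<in>F. right_end I e = v}" and ?Gv = "{e\<in>G. right_end I e = v}"
  let ?Dv = "{e\<in>D. right_end I e = v}" and ?SG = "{e\<in>G. right_end I e = v \<and> left_end I e \<in> A}"
  let ?SD = "{e\<in>D. right_end I e = v \<and> left_end I e \<in> A}"
  have "{e\<in>swap A. right_end I e = v} \<subseteq> (?Fv - \<pi> ` ?SD) \<union> ?SG"
    by (auto simp: swap_def)
  then have "card {e\<in>swap A. right_end I e = v} \<le> card ((?Fv - \<pi> ` ?SD) \<union> ?SG)"
    using finite_FG by (intro card_mono) auto
  also have "\<dots> \<le> card (?Fv - \<pi> ` ?SD) + card ?SG"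
    by (rule card_Un_le)
  finally have *: "card {e\<in>swap A. right_end I e = v} \<le> card (?Fv - \<pi> ` ?SD) + card ?SG" .
  have SD: "\<pi> ` ?SD \<subseteq> ?Fv"
    using \<pi> by auto
  have cSD: "card (\<pi> ` ?SD) = card ?SD"
    using inj by (intro card_image) (auto elim: inj_on_subset)
  have cF: "card (?Fv - \<pi> ` ?SD) = card ?Fv - card ?SD" "card ?SD \<le> card ?Fv"
    using SD cSD finite_FG card_mono[OF _ SD] by (simp_all add: card_Diff_subset)
  from maximal[of v] show ?thesis
  proof
    assume "?Dv = ?Gv"
    then have "?SD = ?SG" by blast
    then show ?thesis using * cF by simp
  next
    assume eq: "\<pi> ` ?Dv = ?Fv"
    have "card ?Fv = card ?Dv"
      unfolding eq[symmetric] using inj by (intro card_image) (auto elim: inj_on_subset)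
    moreover have "card ?Dv - card ?SD = card (?Dv - ?SD)"
      using finite_FG by (intro card_Diff_subset[symmetric]) auto
    moreover have "card (?Dv - ?SD) + card ?SG = card ((?Dv - ?SD) \<union> ?SG)"
      using finite_FG by (intro card_Un_disjoint[symmetric]) auto
    moreover have "card ((?Dv - ?SD) \<union> ?SG) \<le> card ?Gv"
      using finite_FG D by (intro card_mono) auto
    ultimately show ?thesis using * cF by linarith
  qed
qed

lemma within_capacity_swap: "within_capacity I (swap A)"
  unfolding within_capacity_def
proof (intro conjI ballI)
  show sub: "swap A \<subseteq> edges I"
    using FG_edges by (auto simp: swap_def)
  have capF: "enat (card {e\<in>F. left_end I e = w \<or> right_end I e = w}) \<le> capacity I w"
    and capG: "enat (card {e\<in>G. left_end I e = w \<or> right_end I e = w}) \<le> capacity I w"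
    if "w \<in> lefts I \<union> rights I" for w
    using F G that by (auto simp: within_capacity_def)
  fix w assume w: "w \<in> lefts I \<union> rights I"
  show "enat (card {e \<in> swap A. left_end I e = w \<or> right_end I e = w}) \<le> capacity I w"
  proof (cases "w \<in> lefts I")
    case True
    have "card (at_left I (swap A) w) \<le> max (card (at_left I F w)) (card (at_left I G w))"
    proof (cases "w \<in> A")
      case False
      then have "card (at_left I (swap A) w) \<le> card (at_left I F w)"
        using finite_FG unfolding at_left_swap_out[OF False]
        by (intro card_mono) (auto simp: at_left_def)
      then show ?thesis by simp
    qed (simp add: at_left_swap_in)
    then show ?thesis
      using capF[OF w] capG[OF w] True sub FG_edges
      by (auto simp: incident_left max_def simp del: enat_ord_simps split: if_splits
          intro: order_trans[rotated] enat_ord_simps(1)[THEN iffD2])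
  next
    case False
    then have "w \<in> rights I" using w by simp
    then show ?thesis
      using card_right_swap[of A w] capF[OF w] capG[OF w] sub FG_edges
      by (auto simp: incident_right max_def split: if_splits intro: order_trans[rotated])
  qed
qed

end

context exchange
begin

text \<open>Vertices of \<open>A\<close> now earn the value of \<open>G\<close>. A vertex outside
  keeps all but its evicted edges and its minimum cannot fall, so it loses at most its price per
  evicted edge. Evictions inside \<open>A\<close> cost nothing extra, as the revenue of
  \<open>F\<close> there is given up anyway.\<close>

lemma swap_inequality:
  assumes A: "A \<subseteq> lefts I" and local: "gain I b (swap A) \<le> gain I b F"
    and b: "\<And>e. e \<in> edges I \<Longrightarrow> 0 \<le> b e"
  defines "p \<equiv> \<lambda>u. Min (b ` at_left I F u)"
  shows "(\<Sum>u\<in>A. real (card (at_left I G u)) * Min (b ` at_left I G u)) \<le>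
    (\<Sum>u\<in>A. real (card (at_left I F u)) * p u) +
    (\<Sum>e | e \<in> D \<and> left_end I e \<in> A \<and> left_end I (\<pi> e) \<notin> A. p (left_end I (\<pi> e)))"
proof -
  define E where "E u = {e\<in>D. left_end I e \<in> A \<and> left_end I (\<pi> e) = u}" for u
  let ?value = "\<lambda>H u. real (card (at_left I H u)) * Min (b ` at_left I H u)"
  have fin: "finite A" "finite (lefts I - A)" "finite (at_left I F u)" "finite (E u)" for u
    using A finite_lefts finite_subset finite_FG by (auto simp: at_left_def E_def)
  have out: "?value F u - real (card (E u)) * p u \<le> ?value (swap A) u" if u: "u \<in> lefts I - A" for u
  proof -
    have S: "at_left I (swap A) u = at_left I F u - \<pi> ` E u"
      using at_left_swap_out u by (auto simp: E_def)
    have \<pi>E: "\<pi> ` E u \<subseteq> at_left I F u"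
      using \<pi> by (auto simp: E_def at_left_def)
    show ?thesis
    proof (cases "at_left I F u = {}")
      case True
      then have "E u = {}" using \<pi>E by auto
      then show ?thesis using True S by simp
    next
      case False
      have p0: "0 \<le> p u"
        unfolding p_def using fin False b FG_edges by (subst Min_ge_iff) (auto simp: at_left_def)
      have "real (card (at_left I F u)) - real (card (E u)) \<le> real (card (at_left I (swap A) u))"
        unfolding S using diff_card_le_card_Diff[of "\<pi> ` E u" "at_left I F u"] card_image_le[of "E u" \<pi>] fin
        by simp
      then have "(real (card (at_left I F u)) - real (card (E u))) * p u \<le> real (card (at_left I (swap A) u)) * p u"
        using p0 by (intro mult_right_mono)
      \<comment> \<open>Removing edges can only raise the minimum; if no edge is left, both sides
        are 0.\<close>
      also have "\<dots> \<le> ?value (swap A) u"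
      proof (cases "at_left I (swap A) u = {}")
        case ne: False
        then have "p u \<le> Min (b ` at_left I (swap A) u)"
          unfolding p_def using fin by (intro Min_antimono) (auto simp: S)
        then show ?thesis by (intro mult_left_mono) auto
      qed simp
      finally show ?thesis by (simp add: p_def algebra_simps)
    qed
  qed
  have "(\<Sum>u\<in>A. ?value G u) + ((\<Sum>u\<in>lefts I - A. ?value F u) - (\<Sum>u\<in>lefts I - A. real (card (E u)) * p u))
      \<le> (\<Sum>u\<in>A. ?value (swap A) u) + (\<Sum>u\<in>lefts I - A. ?value (swap A) u)"
    using out by (intro add_mono) (auto simp: at_left_swap_in sum_subtractf[symmetric] intro!: sum_mono)
  also have "\<dots> = gain I b (swap A)"
    unfolding gain_def using A finite_lefts by (simp add: sum.subset_diff add.commute)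
  also have "\<dots> \<le> gain I b F"
    by (rule local)
  also have "\<dots> = (\<Sum>u\<in>A. ?value F u) + (\<Sum>u\<in>lefts I - A. ?value F u)"
    unfolding gain_def using A finite_lefts by (simp add: sum.subset_diff add.commute)
  finally have main: "(\<Sum>u\<in>A. ?value G u) \<le> (\<Sum>u\<in>A. ?value F u) + (\<Sum>u\<in>lefts I - A. real (card (E u)) * p u)"
    by simp
  let ?X = "{e\<in>D. left_end I e \<in> A \<and> left_end I (\<pi> e) \<notin> A}"
  have "left_end I (\<pi> e) \<in> lefts I" if "e \<in> D" for e
    using \<pi>[OF that] FG_edges left_end by blast
  then have "(\<Sum>e\<in>?X. p (left_end I (\<pi> e))) = (\<Sum>u\<in>lefts I - A. \<Sum>e | e \<in> ?X \<and> left_end I (\<pi> e) = u. p (left_end I (\<pi> e)))"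
    using finite_FG fin by (intro sum.group[symmetric]) auto
  also have "\<dots> = (\<Sum>u\<in>lefts I - A. \<Sum>e\<in>E u. p u)"
    by (intro sum.cong) (auto simp: E_def)
  finally show ?thesis
    using main by (simp add: p_def)
qed

section \<open>Labels and averaging over the levels\<close>

text \<open>
  A label \<open>i < C\<close> selects at most one edge \<open>e\<close> of \<open>G\<close> at every left vertex \<open>u\<close>, and \<open>succ i\<close> maps \<open>u\<close>
  to the left vertex that loses the edge \<open>\<pi> e\<close>. If \<open>A\<close> contains \<open>u\<close> and \<open>succ i u\<close>, then \<open>swap A\<close> is not
  charged for \<open>\<pi> e\<close>.
\<close>

definition label :: "'b \<Rightarrow> nat" where
  "label = (SOME l. \<forall>u\<in>lefts I. inj_on l (at_left I G u) \<and> l ` at_left I G u \<subseteq> {..<C})"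

lemma label: "u \<in> lefts I \<Longrightarrow> inj_on label (at_left I G u)"
    "e \<in> G \<Longrightarrow> label e < C"
proof -
  have "\<exists>f. f ` at_left I G u \<subseteq> {..<C} \<and> inj_on f (at_left I G u)" if "u \<in> lefts I" for u
    using card_at_left[OF G that] finite_FG by (intro card_le_inj) (auto simp: at_left_def)
  then obtain f where f: "\<And>u. u \<in> lefts I \<Longrightarrow> f u ` at_left I G u \<subseteq> {..<C} \<and> inj_on (f u) (at_left I G u)"
    by metis
  have "\<forall>u\<in>lefts I. inj_on (\<lambda>e. f (left_end I e) e) (at_left I G u) \<and>
      (\<lambda>e. f (left_end I e) e) ` at_left I G u \<subseteq> {..<C}"
    using f by (fastforce simp: at_left_def inj_on_def)
  then have "\<exists>l. \<forall>u\<in>lefts I. inj_on l (at_left I G u) \<and> l ` at_left I G u \<subseteq> {..<C}"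
    by (intro exI[where x = "\<lambda>e. f (left_end I e) e"])
  from someI_ex[OF this]
  have *: "\<forall>u\<in>lefts I. inj_on label (at_left I G u) \<and> label ` at_left I G u \<subseteq> {..<C}"
    unfolding label_def .
  then show "u \<in> lefts I \<Longrightarrow> inj_on label (at_left I G u)" by blast
  assume "e \<in> G"
  then have "left_end I e \<in> lefts I" "e \<in> at_left I G (left_end I e)"
    using FG_edges left_end by (auto simp: at_left_def)
  then show "label e < C" using * by blast
qed

text \<open>A vertex without a matched edge of label \<open>i\<close> becomes a fixed point, whose
  arc leaves no set.\<close>

definition succ :: "nat \<Rightarrow> 'a \<Rightarrow> 'a" where
  "succ i u = (if \<exists>e\<in>D. left_end I e = u \<and> label e = i
     then left_end I (\<pi> (SOME e. e \<in> D \<and> left_end I e = u \<and> label e = i)) else u)"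

lemma succ_eq:
  assumes "e \<in> D"
  shows "succ (label e) (left_end I e) = left_end I (\<pi> e)"
proof -
  let ?P = "\<lambda>f. f \<in> D \<and> left_end I f = left_end I e \<and> label f = label e"
  have P: "?P (SOME f. ?P f)"
    using assms by (intro someI[of ?P e]) auto
  moreover have "left_end I e \<in> lefts I"
    using assms D FG_edges left_end by blast
  ultimately have "(SOME f. ?P f) = e"
    using label(1)[of "left_end I e"] assms D by (auto simp: at_left_def inj_on_def)
  then show ?thesis
    using assms by (auto simp: succ_def)
qed

lemma succ_cases:
  obtains e where "e \<in> D" "left_end I e = u" "succ i u = left_end I (\<pi> e)" | "succ i u = u"
proof (cases "\<exists>e\<in>D. left_end I e = u \<and> label e = i")
  case True
  then show ?thesis using succ_eq that(1) by blast
next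
  case False
  then have "succ i u = u" by (auto simp: succ_def)
  then show ?thesis by (rule that(2))
qed

lemma succ_image: "succ i ` lefts I \<subseteq> lefts I"
proof
  fix y assume "y \<in> succ i ` lefts I"
  then obtain u where "u \<in> lefts I" "y = succ i u" by blast
  then show "y \<in> lefts I"
    by (cases rule: succ_cases[of u i]) (use \<pi> FG_edges left_end in auto)
qed

text \<open>Besides \<open>y\<close> itself, which may be a fixed point, a preimage comes from an
  edge that evicts an edge of \<open>F\<close> at \<open>y\<close>. These evicted edges are distinct
  since \<open>\<pi>\<close> is injective, so there are at most \<open>C\<close> of them.\<close>

lemma card_succ_fibre:
  assumes "y \<in> lefts I"
  shows "card {u\<in>lefts I. succ i u = y} \<le> Suc C"
proof -
  let ?X = "{e\<in>D. left_end I (\<pi> e) = y}"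
  have "{u\<in>lefts I. succ i u = y} \<subseteq> insert y (left_end I ` ?X)"
  proof
    fix u assume "u \<in> {u\<in>lefts I. succ i u = y}"
    then show "u \<in> insert y (left_end I ` ?X)"
      by (cases rule: succ_cases[of u i]) auto
  qed
  then have "card {u\<in>lefts I. succ i u = y} \<le> card (insert y (left_end I ` ?X))"
    using finite_FG by (intro card_mono) auto
  also have "\<dots> \<le> Suc (card (left_end I ` ?X))"
    using finite_FG by (simp add: card_insert_if)
  also have "card (left_end I ` ?X) \<le> card ?X"
    using finite_FG by (intro card_image_le) auto
  also have "card ?X = card (\<pi> ` ?X)"
    using inj by (intro card_image[symmetric]) (auto elim: inj_on_subset)
  also have "\<dots> \<le> card (at_left I F y)"
    using \<pi> finite_FG by (intro card_mono) (auto simp: at_left_def)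
  also have "\<dots> \<le> C"
    by (rule card_at_left[OF F assms])
  finally show ?thesis by simp
qed

text \<open>By injectivity each edge of \<open>F\<close> is evicted by at most one edge of
  \<open>D\<close>, and \<open>gain\<close> is the sum of the prices over all of
  \<open>F\<close>.\<close>

lemma sum_charges_le_gain:
  assumes b: "\<And>e. e \<in> edges I \<Longrightarrow> 0 \<le> b e"
  shows "(\<Sum>e\<in>D. Min (b ` at_left I F (left_end I (\<pi> e)))) \<le> gain I b F"
proof -
  let ?p = "\<lambda>e. Min (b ` at_left I F (left_end I e))"
  have p0: "0 \<le> ?p e" if "e \<in> F" for e
    using that b FG_edges finite_FG by (subst Min_ge_iff) (auto simp: at_left_def)
  have "(\<Sum>e\<in>D. ?p (\<pi> e)) = (\<Sum>e\<in>\<pi> ` D. ?p e)"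
    using inj by (simp add: sum.reindex)
  also have "\<dots> \<le> (\<Sum>e\<in>F. ?p e)"
    using \<pi> p0 finite_FG by (intro sum_mono2) auto
  also have "\<dots> = (\<Sum>u\<in>lefts I. \<Sum>e | e \<in> F \<and> left_end I e = u. ?p e)"
    using finite_FG finite_lefts FG_edges left_end by (intro sum.group[symmetric]) auto
  also have "\<dots> = (\<Sum>u\<in>lefts I. \<Sum>e\<in>at_left I F u. Min (b ` at_left I F u))"
    by (intro sum.cong) (auto simp: at_left_def)
  finally show ?thesis
    by (simp add: gain_def)
qed

text \<open>The swap inequalities are summed over all levels of \<open>succ i\<close> and then over
  \<open>i\<close>. An edge of \<open>D\<close> is charged at most once under its own label and at
  most \<rho> + 1 times under each of the other \<open>C - 1\<close> labels.\<close>

lemma gain_le_of_local_optimum: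
  assumes b: "\<And>e. e \<in> edges I \<Longrightarrow> 0 \<le> b e"
    and local: "\<And>H. within_capacity I H \<Longrightarrow>
      card ((F - H) \<union> (H - F)) \<le> 3 * (Suc \<rho> * Suc C ^ \<rho> * C) \<Longrightarrow> gain I b H \<le> gain I b F"
    and C: "1 \<le> C"
  shows "real C * real (Suc \<rho>) * gain I b G \<le> ((2 * real C - 1) * real (Suc \<rho>) + 1) * gain I b F"
proof -
  define p where "p u = Min (b ` at_left I F u)" for u
  define q where "q e = p (left_end I (\<pi> e))" for e
  let ?J = "lefts I \<times> {1..Suc \<rho>}"
  let ?value = "\<lambda>H u. real (card (at_left I H u)) * Min (b ` at_left I H u)"
  have q0: "0 \<le> q e" if "e \<in> D" for e
    unfolding q_def p_def using that \<pi> b FG_edges finite_FG by (subst Min_ge_iff) (auto simp: at_left_def)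
  have finJ: "finite ?J" using finite_lefts by simp
  have average: "real (Suc \<rho>) * gain I b G \<le> real (Suc \<rho>) * gain I b F +
      (\<Sum>e\<in>D. (if label e = i then 1 else real (Suc \<rho>)) * q e)" for i
  proof -
    let ?A = "orbit_level (lefts I) \<rho> (succ i)"
    have A: "?A j \<subseteq> lefts I" for j
      by (cases j) (auto simp: orbit_level_def)
    have "real (Suc \<rho>) * gain I b G = (\<Sum>j\<in>?J. \<Sum>u\<in>?A j. ?value G u)"
      using card_levels_containing[OF finite_lefts succ_image]
      by (subst sum_over_family[OF finJ finite_lefts A]) (simp add: gain_def sum_distrib_left)
    also have "\<dots> \<le> (\<Sum>j\<in>?J. (\<Sum>u\<in>?A j. ?value F u) +
        (\<Sum>e | e \<in> D \<and> left_end I e \<in> ?A j \<and> left_end I (\<pi> e) \<notin> ?A j. q e))"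
    proof (rule sum_mono)
      fix j assume j: "j \<in> ?J"
      have "card (?A j) \<le> Suc \<rho> * Suc C ^ \<rho>"
        using card_orbit_level[OF finite_lefts succ_image card_succ_fibre _ j] by simp
      then have "card ((F - swap (?A j)) \<union> (swap (?A j) - F)) \<le> 3 * (Suc \<rho> * Suc C ^ \<rho> * C)"
        using card_swap_diff[OF A[of j]] by (meson mult_le_mono order_refl order_trans)
      then have "gain I b (swap (?A j)) \<le> gain I b F"
        by (intro local within_capacity_swap)
      from swap_inequality[OF A this b]
      show "(\<Sum>u\<in>?A j. ?value G u) \<le> (\<Sum>u\<in>?A j. ?value F u) +
          (\<Sum>e | e \<in> D \<and> left_end I e \<in> ?A j \<and> left_end I (\<pi> e) \<notin> ?A j. q e)"
        by (simp add: q_def p_def)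
    qed
    also have "\<dots> = (\<Sum>j\<in>?J. \<Sum>u\<in>?A j. ?value F u) +
        (\<Sum>j\<in>?J. \<Sum>e | e \<in> D \<and> left_end I e \<in> ?A j \<and> left_end I (\<pi> e) \<notin> ?A j. q e)"
      by (rule sum.distrib)
    also have "(\<Sum>j\<in>?J. \<Sum>u\<in>?A j. ?value F u) = real (Suc \<rho>) * gain I b F"
      using card_levels_containing[OF finite_lefts succ_image]
      by (subst sum_over_family[OF finJ finite_lefts A]) (simp add: gain_def sum_distrib_left)
    also have "(\<Sum>j\<in>?J. \<Sum>e | e \<in> D \<and> left_end I e \<in> ?A j \<and> left_end I (\<pi> e) \<notin> ?A j. q e) =
        (\<Sum>e\<in>D. real (card {j\<in>?J. e \<in> {e\<in>D. left_end I e \<in> ?A j \<and> left_end I (\<pi> e) \<notin> ?A j}}) * q e)"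
      by (rule sum_over_family[OF finJ finite_FG(3)]) auto
    also have "\<dots> \<le> (\<Sum>e\<in>D. (if label e = i then 1 else real (Suc \<rho>)) * q e)"
    proof (intro sum_mono mult_right_mono q0)
      fix e assume e: "e \<in> D"
      let ?X = "{j\<in>?J. e \<in> {e\<in>D. left_end I e \<in> ?A j \<and> left_end I (\<pi> e) \<notin> ?A j}}"
      have u: "left_end I e \<in> lefts I"
        using e D FG_edges left_end by blast
      show "real (card ?X) \<le> (if label e = i then 1 else real (Suc \<rho>))"
      proof (cases "label e = i")
        case True
        then have "?X = {j\<in>?J. left_end I e \<in> ?A j \<and> succ i (left_end I e) \<notin> ?A j}"
          using succ_eq[OF e] e by auto
        then show ?thesis
          using True card_levels_cut[OF succ_image u, of \<rho> i] by simp
      next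
        case False
        have "card ?X \<le> card {j\<in>?J. left_end I e \<in> ?A j}"
          using finJ by (intro card_mono) auto
        then show ?thesis
          using False card_levels_containing[OF finite_lefts succ_image u, of \<rho> i] by simp
      qed
    qed
    finally show ?thesis by simp
  qed
  have "real C * (real (Suc \<rho>) * gain I b G) = (\<Sum>i<C. real (Suc \<rho>) * gain I b G)"
    by simp
  also have "\<dots> \<le> (\<Sum>i<C. real (Suc \<rho>) * gain I b F +
      (\<Sum>e\<in>D. (if label e = i then 1 else real (Suc \<rho>)) * q e))"
    by (intro sum_mono average)
  also have "\<dots> = real C * (real (Suc \<rho>) * gain I b F) +
      (\<Sum>e\<in>D. (\<Sum>i<C. if label e = i then 1 else real (Suc \<rho>)) * q e)"
    by (simp add: sum.distrib sum.swap[of _ D] sum_distrib_right)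
  also have "(\<Sum>e\<in>D. (\<Sum>i<C. if label e = i then 1 else real (Suc \<rho>)) * q e) =
      ((real C - 1) * real (Suc \<rho>) + 1) * (\<Sum>e\<in>D. q e)"
    unfolding sum_distrib_left
  proof (rule sum.cong[OF refl])
    fix e assume "e \<in> D"
    then have l: "label e < C" using D label(2) by blast
    \<comment> \<open>Every label contributes \<rho> + 1, corrected by - \<rho> at the single label
      of \<open>e\<close>.\<close>
    have "(\<Sum>i<C. if label e = i then 1 else real (Suc \<rho>)) =
        (\<Sum>i<C. real (Suc \<rho>) + (if label e = i then - real \<rho> else 0))"
      by (intro sum.cong) auto
    also have "\<dots> = (real C - 1) * real (Suc \<rho>) + 1"
      using l by (simp add: sum.distrib algebra_simps)
    finally show "(\<Sum>i<C. if label e = i then 1 else real (Suc \<rho>)) * q e =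
        ((real C - 1) * real (Suc \<rho>) + 1) * q e" by simp
  qed
  also have "\<dots> \<le> ((real C - 1) * real (Suc \<rho>) + 1) * gain I b F"
    using sum_charges_le_gain[OF b] C by (intro mult_left_mono) (auto simp: q_def p_def)
  finally show ?thesis
    by (simp add: algebra_simps)
qed

end

subsection \<open>Rounded budgets\<close>

abbreviation real_budget :: "('v, 'e) pricing \<Rightarrow> 'e \<Rightarrow> real" where
  "real_budget I e \<equiv> of_rat (budget I e)"

context capacitated
begin

lemma local_optimum_ratio:
  assumes F: "within_capacity I F" and G: "within_capacity I G"
    and b: "\<And>e. e \<in> edges I \<Longrightarrow> 0 \<le> b e"
    and local: "\<And>H. within_capacity I H \<Longrightarrow>
      card ((F - H) \<union> (H - F)) \<le> 3 * (Suc \<rho> * Suc C ^ \<rho> * C) \<Longrightarrow> gain I b H \<le> gain I b F"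
    and C: "1 \<le> C"
  shows "real C * real (Suc \<rho>) * gain I b G \<le> ((2 * real C - 1) * real (Suc \<rho>) + 1) * gain I b F"
proof -
  have "finite F" "finite G"
    using F G finite_edges by (auto simp: within_capacity_def)
  from exists_fibrewise_matching[OF this, of "right_end I"] obtain D \<pi> where
    "exchange I C F G D \<pi>"
    using F G capacitated_axioms by (auto simp: exchange_def exchange_axioms_def)
  then interpret exchange I C F G D \<pi> .
  show ?thesis using gain_le_of_local_optimum[OF b local C] by blast
qed

lemma sum_card_at_left:
  assumes "F \<subseteq> edges I"
  shows "(\<Sum>u\<in>lefts I. \<Sum>e\<in>at_left I F u. f e) = (\<Sum>e\<in>F. f e :: real)"
  unfolding at_left_def
  using assms left_end by (intro sum.group finite_edges finite_lefts) auto

text \<open>The edge that attains the minimum of \<open>y\<close> at a left vertex also bounds the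
  minimum of \<open>x\<close> there. The case \<open>k = 0\<close> bounds \<open>gain\<close> by a
  multiple of the number of edges.\<close>

lemma gain_mono_affine:
  assumes G: "G \<subseteq> edges I" and le: "\<And>e. e \<in> G \<Longrightarrow> x e \<le> k * y e + \<delta>"
  shows "gain I x G \<le> k * gain I y G + \<delta> * real (card G)"
proof -
  have fin: "finite (at_left I G u)" for u
    using finite_edges[OF G] by (simp add: at_left_def)
  have "real (card (at_left I G u)) * Min (x ` at_left I G u) \<le>
      k * (real (card (at_left I G u)) * Min (y ` at_left I G u)) + (\<Sum>e\<in>at_left I G u. \<delta>)" for u
  proof (cases "at_left I G u = {}")
    case False
    then have "Min (y ` at_left I G u) \<in> y ` at_left I G u"
      using fin by (intro Min_in) auto
    then obtain e where e: "e \<in> at_left I G u" "Min (y ` at_left I G u) = y e"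
      by blast
    then have "Min (x ` at_left I G u) \<le> x e"
      using fin by (intro Min_le) auto
    also have "\<dots> \<le> k * y e + \<delta>"
      using e by (intro le) (auto simp: at_left_def)
    finally have "real (card (at_left I G u)) * Min (x ` at_left I G u) \<le>
        real (card (at_left I G u)) * (k * y e + \<delta>)"
      by (intro mult_left_mono) auto
    then show ?thesis using e by (simp add: algebra_simps)
  qed simp
  then have "gain I x G \<le> (\<Sum>u\<in>lefts I. k * (real (card (at_left I G u)) * Min (y ` at_left I G u)) +
      (\<Sum>e\<in>at_left I G u. \<delta>))"
    unfolding gain_def by (intro sum_mono)
  also have "\<dots> = k * gain I y G + \<delta> * real (card G)"
    unfolding sum.distrib sum_card_at_left[OF G] gain_def by (simp add: sum_distrib_left)
  finally show ?thesis .
qed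

lemma gain_nonneg:
  assumes "F \<subseteq> edges I" "\<And>e. e \<in> F \<Longrightarrow> 0 \<le> b e"
  shows "0 \<le> gain I b F"
  unfolding gain_def
proof (rule sum_nonneg)
  fix u
  show "0 \<le> real (card (at_left I F u)) * Min (b ` at_left I F u)"
  proof (cases "at_left I F u = {}")
    case False
    then have "0 \<le> Min (b ` at_left I F u)"
      using finite_edges[OF assms(1)] assms(2) by (subst Min_ge_iff) (auto simp: at_left_def)
    then show ?thesis by simp
  qed simp
qed

section \<open>Prices versus edge sets\<close>

lemma revenue_eq:
  assumes F: "F \<subseteq> edges I" and p: "\<forall>v\<in>rights I. p v = 0"
  shows "revenue I p F = (\<Sum>u\<in>lefts I. real (card (at_left I F u)) * p u)"
proof -
  have "revenue I p F = (\<Sum>e\<in>F. p (left_end I e))"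
    unfolding revenue_def using F p right_end by (intro sum.cong) auto
  also have "\<dots> = (\<Sum>u\<in>lefts I. \<Sum>e\<in>at_left I F u. p (left_end I e))"
    by (rule sum_card_at_left[OF F, symmetric])
  also have "\<dots> = (\<Sum>u\<in>lefts I. \<Sum>e\<in>at_left I F u. p u)"
    by (intro sum.cong) (auto simp: at_left_def)
  finally show ?thesis by simp
qed

lemma revenue_le_gain:
  assumes "feasible I p F"
  shows "within_capacity I F" "revenue I p F \<le> gain I (real_budget I) F"
proof -
  have F: "F \<subseteq> edges I" and p: "\<forall>v\<in>rights I. p v = 0"
    and le: "\<And>e. e \<in> F \<Longrightarrow> p (left_end I e) \<le> real_budget I e"
    using assms right_end by (fastforce simp: feasible_def)+
  show "within_capacity I F"
    using assms by (auto simp: feasible_def within_capacity_def)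
  have "real (card (at_left I F u)) * p u \<le> real (card (at_left I F u)) * Min (real_budget I ` at_left I F u)" for u
  proof (cases "at_left I F u = {}")
    case False
    have "p u \<le> real_budget I e" if "e \<in> at_left I F u" for e
      using le[of e] that by (auto simp: at_left_def)
    then have "p u \<le> Min (real_budget I ` at_left I F u)"
      using False finite_edges[OF F] by (subst Min_ge_iff) (auto simp: at_left_def)
    then show ?thesis by (intro mult_left_mono) auto
  qed simp
  then show "revenue I p F \<le> gain I (real_budget I) F"
    unfolding revenue_eq[OF F p] gain_def by (intro sum_mono)
qed

lemma opt_revenue_le:
  assumes "\<And>G. within_capacity I G \<Longrightarrow> gain I (real_budget I) G \<le> X"
  shows "opt_revenue I \<le> X"
  unfolding opt_revenue_def
proof (rule cSup_least)
  show "{revenue I p F | p F. feasible I p F} \<noteq> {}"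
    using feasible_empty[OF inst] by blast
  fix x assume "x \<in> {revenue I p F | p F. feasible I p F}"
  then obtain p F where "x = revenue I p F" "feasible I p F" by blast
  then show "x \<le> X"
    using revenue_le_gain[of p F] assms[of F] by linarith
qed

text \<open>Charging the least budget is the best response to a fixed edge set; with
  \<open>revenue_le_gain\<close>, maximizing revenue becomes maximizing \<open>gain\<close>.\<close>

lemma feasible_min_price:
  assumes F: "within_capacity I F"
    and p: "\<And>u. u \<in> lefts I \<Longrightarrow> at_left I F u = {} \<Longrightarrow> p u = 0"
      "\<And>u. u \<in> lefts I \<Longrightarrow> at_left I F u \<noteq> {} \<Longrightarrow> p u = Min (real_budget I ` at_left I F u)"
      "\<And>v. v \<in> rights I \<Longrightarrow> p v = 0"
  shows "feasible I p F" "revenue I p F = gain I (real_budget I) F"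
proof -
  have sub: "F \<subseteq> edges I" using F by (simp add: within_capacity_def)
  have fin: "finite (at_left I F u)" for u
    using finite_edges[OF sub] by (simp add: at_left_def)
  have "0 \<le> p u" if u: "u \<in> lefts I" for u
  proof (cases "at_left I F u = {}")
    case False
    then show ?thesis
      using p(2)[OF u False] fin sub inst by (auto simp: Min_ge_iff at_left_def pricing_instance_def)
  qed (use p(1) u in simp)
  moreover have "p (left_end I e) + p (right_end I e) \<le> real_budget I e" if "e \<in> F" for e
  proof -
    have "e \<in> at_left I F (left_end I e)" using that by (simp add: at_left_def)
    then have "p (left_end I e) \<le> real_budget I e"
      using p(2)[OF left_end] fin sub that by (subst p(2)[OF left_end]) auto
    then show ?thesis using p(3)[of "right_end I e"] right_end sub that by auto
  qed
  ultimately show "feasible I p F"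
    using F p(3) by (auto simp: feasible_def within_capacity_def)
  show "revenue I p F = gain I (real_budget I) F"
  proof -
    have eq: "real (card (at_left I F u)) * p u = real (card (at_left I F u)) * Min (real_budget I ` at_left I F u)"
      if "u \<in> lefts I" for u
      using p(2)[OF that] by (cases "at_left I F u = {}") auto
    have "revenue I p F = (\<Sum>u\<in>lefts I. real (card (at_left I F u)) * p u)"
      using p(3) by (intro revenue_eq[OF sub]) blast
    also have "\<dots> = gain I (real_budget I) F"
      unfolding gain_def by (rule sum.cong[OF refl eq])
    finally show ?thesis .
  qed
qed

text \<open>Local optimality holds for the rounded budgets \<open>b\<close> only. Rounding down does
  not overstate the scaled gain of \<open>F\<close>, and \<open>G\<close> loses at most one unit per
  edge, which is \<open>1 / t\<close> in the original scale.\<close>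

lemma rounded_local_optimum_ratio:
  assumes F: "within_capacity I F" and G: "within_capacity I G"
    and local: "\<And>H. within_capacity I H \<Longrightarrow>
      card ((F - H) \<union> (H - F)) \<le> 3 * (Suc \<rho> * Suc C ^ \<rho> * C) \<Longrightarrow> gain I b H \<le> gain I b F"
    and C: "1 \<le> C" and t: "0 < t"
    and b: "\<And>e. e \<in> edges I \<Longrightarrow> 0 \<le> b e \<and> b e \<le> t * real_budget I e \<and> t * real_budget I e \<le> b e + 1"
  shows "gain I (real_budget I) G \<le>
    (2 - 1 / real C + 1 / (real C * real (Suc \<rho>))) * gain I (real_budget I) F + real (card (edges I)) / t"
proof -
  have sub: "F \<subseteq> edges I" "G \<subseteq> edges I" using F G by (auto simp: within_capacity_def)
  let ?a = "2 - 1 / real C + 1 / (real C * real (Suc \<rho>))"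
  have pos: "0 < real C * real (Suc \<rho>)" using C by simp
  have "real C * real (Suc \<rho>) * ?a = (2 * real C - 1) * real (Suc \<rho>) + 1"
    using C by (simp add: divide_simps del: of_nat_Suc)
  then have "real C * real (Suc \<rho>) * gain I b G \<le> real C * real (Suc \<rho>) * (?a * gain I b F)"
    using local_optimum_ratio[OF F G _ local C] b by (simp add: mult.assoc[symmetric])
  then have 1: "gain I b G \<le> ?a * gain I b F"
    using pos by (simp only: mult_le_cancel_left_pos)
  have "gain I b F \<le> t * gain I (real_budget I) F"
    using gain_mono_affine[OF sub(1), of b t "real_budget I" 0] b sub by auto
  moreover have "1 / real C \<le> 1" "0 \<le> 1 / (real C * real (Suc \<rho>))"
    using C by simp_all
  then have "0 \<le> ?a" by linarith
  ultimately have 2: "?a * gain I b F \<le> ?a * (t * gain I (real_budget I) F)"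
    by (rule mult_left_mono)
  have "gain I (real_budget I) G \<le> (1 / t) * gain I b G + (1 / t) * real (card G)"
    using b sub t by (intro gain_mono_affine) (auto simp: field_simps)
  also have "\<dots> \<le> (1 / t) * (?a * (t * gain I (real_budget I) F)) + (1 / t) * real (card (edges I))"
    using 1 2 t sub inst by (intro add_mono mult_left_mono) (auto simp: pricing_instance_def intro: card_mono)
  finally show ?thesis using t by (simp add: field_simps)
qed

end

section \<open>Reasoning about programs and their costs\<close>

text \<open>
  Costs are measured in units of \<open>2 * m + 3\<close>, the maximal cost of an arithmetic operation on
  operands of absolute value below \<open>2 ^ m\<close>.
\<close>

definition evaluates :: "nat \<Rightarrow> program \<Rightarrow> val list \<Rightarrow> expr \<Rightarrow> val \<Rightarrow> nat \<Rightarrow> bool" where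
  "evaluates m P \<rho> a x k \<longleftrightarrow> (\<exists>t. eval P \<rho> a x t \<and> t \<le> k * (2 * m + 3))"

definition evaluates_list :: "nat \<Rightarrow> program \<Rightarrow> val list \<Rightarrow> expr list \<Rightarrow> val list \<Rightarrow> nat \<Rightarrow> bool" where
  "evaluates_list m P \<rho> as xs k \<longleftrightarrow> (\<exists>t. eval_list P \<rho> as xs t \<and> t \<le> k * (2 * m + 3))"

definition runs :: "nat \<Rightarrow> program \<Rightarrow> nat \<Rightarrow> val list \<Rightarrow> val \<Rightarrow> nat \<Rightarrow> bool" where
  "runs m P f xs y k \<longleftrightarrow> f < length P \<and> evaluates m P xs (P ! f) y k"

definition call :: "nat \<Rightarrow> program \<Rightarrow> nat \<Rightarrow> val list \<Rightarrow> (val \<Rightarrow> nat \<Rightarrow> bool) \<Rightarrow> bool" where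
  "call m P f xs Q \<longleftrightarrow> (\<exists>y k. runs m P f xs y k \<and> Q y k)"

primrec on_num :: "val \<Rightarrow> (int \<Rightarrow> bool) \<Rightarrow> bool" where
  "on_num (Num i) R = R i"
| "on_num (Pr x y) R = False"

primrec on_pair :: "val \<Rightarrow> (val \<Rightarrow> val \<Rightarrow> bool) \<Rightarrow> bool" where
  "on_pair (Num i) R = False"
| "on_pair (Pr x y) R = R x y"

primrec is_pair :: "val \<Rightarrow> bool" where
  "is_pair (Num i) = False"
| "is_pair (Pr x y) = True"

text \<open>A weakest precondition calculus with costs, for total correctness. Calls stay opaque and
  are discharged by \<open>runs\<close> facts, so recursion is handled by induction outside the
  calculus. The bound on operands keeps an arithmetic operation within one unit, as 1 + 2 (m + 1) =
  2 m + 3.\<close>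

fun wp :: "nat \<Rightarrow> program \<Rightarrow> val list \<Rightarrow> expr \<Rightarrow> (val \<Rightarrow> nat \<Rightarrow> bool) \<Rightarrow> bool"
  and wps :: "nat \<Rightarrow> program \<Rightarrow> val list \<Rightarrow> expr list \<Rightarrow> (val list \<Rightarrow> nat \<Rightarrow> bool) \<Rightarrow> bool" where
  "wp m P \<rho> (Var n) Q = (n < length \<rho> \<and> Q (\<rho> ! n) 1)"
| "wp m P \<rho> (Lit i) Q = Q (Num i) 1"
| "wp m P \<rho> (Op f a b) Q = wp m P \<rho> a (\<lambda>x s. wp m P \<rho> b (\<lambda>y t. on_num x (\<lambda>i. on_num y (\<lambda>j.
     \<bar>i\<bar> < 2 ^ m \<and> \<bar>j\<bar> < 2 ^ m \<and> Q (Num (binop_sem f i j)) (s + t + 1)))))"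
| "wp m P \<rho> (MkPair a b) Q = wp m P \<rho> a (\<lambda>x s. wp m P \<rho> b (\<lambda>y t. Q (Pr x y) (s + t + 1)))"
| "wp m P \<rho> (First a) Q = wp m P \<rho> a (\<lambda>x s. on_pair x (\<lambda>y z. Q y (s + 1)))"
| "wp m P \<rho> (Second a) Q = wp m P \<rho> a (\<lambda>x s. on_pair x (\<lambda>y z. Q z (s + 1)))"
| "wp m P \<rho> (IsPair a) Q = wp m P \<rho> a (\<lambda>x s. Q (Num (if is_pair x then 1 else 0)) (s + 1))"
| "wp m P \<rho> (IfE a b c) Q = wp m P \<rho> a (\<lambda>x s. on_num x (\<lambda>i.
     if i = 0 then wp m P \<rho> c (\<lambda>y t. Q y (s + t + 1)) else wp m P \<rho> b (\<lambda>y t. Q y (s + t + 1))))"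
| "wp m P \<rho> (LetE a b) Q = wp m P \<rho> a (\<lambda>x s. wp m P (x # \<rho>) b (\<lambda>y t. Q y (s + t + 1)))"
| "wp m P \<rho> (Call f as) Q = wps m P \<rho> as (\<lambda>xs s. call m P f xs (\<lambda>y t. Q y (s + t + 1)))"
| "wps m P \<rho> [] Q = Q [] 0"
| "wps m P \<rho> (a # as) Q = wp m P \<rho> a (\<lambda>x s. wps m P \<rho> as (\<lambda>xs t. Q (x # xs) (s + t)))"

lemma bit_size_le:
  assumes "\<bar>i\<bar> < 2 ^ m"
  shows "bit_size i \<le> m + 1"
proof -
  have "nat \<bar>i\<bar> < 2 ^ m"
    using assms by (simp add: nat_less_iff)
  then show ?thesis
    by (simp add: bit_size_def floorlog_leI)
qed

lemma evaluatesI: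
  "eval P \<rho> a x t \<Longrightarrow> t \<le> k * (2 * m + 3) \<Longrightarrow> evaluates m P \<rho> a x k"
  by (auto simp: evaluates_def)

lemma wp_sound:
  "wp m P \<rho> a Q \<Longrightarrow> \<exists>x k. evaluates m P \<rho> a x k \<and> Q x k"
  "wps m P \<rho> as R \<Longrightarrow> \<exists>xs k. evaluates_list m P \<rho> as xs k \<and> R xs k"
proof (induction m P \<rho> a Q and m P \<rho> as R rule: wp_wps.induct)
  case (1 m P \<rho> n Q)
  then show ?case
    by (intro exI[of _ "\<rho> ! n"] exI[of _ 1]) (auto simp: evaluates_def intro!: exI eval_Var)
next
  case (2 m P \<rho> i Q)
  then show ?case
    by (intro exI[of _ "Num i"] exI[of _ 1]) (auto simp: evaluates_def intro!: exI eval_Lit)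
next
  case (3 m P \<rho> f a b Q)
  from 3(2)[OF 3(3)[unfolded wp.simps]] obtain x s where x: "evaluates m P \<rho> a x s"
    and "wp m P \<rho> b (\<lambda>y t. on_num x (\<lambda>i. on_num y (\<lambda>j.
     \<bar>i\<bar> < 2 ^ m \<and> \<bar>j\<bar> < 2 ^ m \<and> Q (Num (binop_sem f i j)) (s + t + 1))))" by blast
  from 3(1)[OF this(2)] obtain y t where y: "evaluates m P \<rho> b y t" and
    "on_num x (\<lambda>i. on_num y (\<lambda>j. \<bar>i\<bar> < 2 ^ m \<and> \<bar>j\<bar> < 2 ^ m \<and> Q (Num (binop_sem f i j)) (s + t + 1)))"
    by blast
  then obtain i j where ij: "x = Num i" "y = Num j" "\<bar>i\<bar> < 2 ^ m" "\<bar>j\<bar> < 2 ^ m"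
    and Q: "Q (Num (binop_sem f i j)) (s + t + 1)"
    by (cases x; cases y) auto
  from x y ij obtain s' t' where "eval P \<rho> a (Num i) s'" "eval P \<rho> b (Num j) t'"
    and le: "s' \<le> s * (2 * m + 3)" "t' \<le> t * (2 * m + 3)"
    by (auto simp: evaluates_def)
  from eval_Op[OF this(1,2)]
  have "evaluates m P \<rho> (Op f a b) (Num (binop_sem f i j)) (s + t + 1)"
    by (rule evaluatesI) (use le bit_size_le[OF ij(3)] bit_size_le[OF ij(4)] in \<open>simp add: algebra_simps\<close>)
  with Q show ?case by blast
next
  case (4 m P \<rho> a b Q)
  from 4(2)[OF 4(3)[unfolded wp.simps]] obtain x s where x: "evaluates m P \<rho> a x s"
    and "wp m P \<rho> b (\<lambda>y t. Q (Pr x y) (s + t + 1))" by blast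
  from 4(1)[OF this(2)] obtain y t where y: "evaluates m P \<rho> b y t" and Q: "Q (Pr x y) (s + t + 1)"
    by blast
  from x y obtain s' t' where "eval P \<rho> a x s'" "eval P \<rho> b y t'"
    and le: "s' \<le> s * (2 * m + 3)" "t' \<le> t * (2 * m + 3)"
    by (auto simp: evaluates_def)
  from eval_MkPair[OF this(1,2)] have "evaluates m P \<rho> (MkPair a b) (Pr x y) (s + t + 1)"
    by (rule evaluatesI) (use le in \<open>simp add: algebra_simps\<close>)
  with Q show ?case by blast
next
  case (5 m P \<rho> a Q)
  from 5(1)[OF 5(2)[unfolded wp.simps]] obtain x s where x: "evaluates m P \<rho> a x s"
    and "on_pair x (\<lambda>y z. Q y (s + 1))" by blast
  then obtain y z where xyz: "x = Pr y z" and Q: "Q y (s + 1)"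
    by (cases x) auto
  from x xyz obtain s' where "eval P \<rho> a (Pr y z) s'" and le: "s' \<le> s * (2 * m + 3)"
    by (auto simp: evaluates_def)
  from eval_First[OF this(1)] have "evaluates m P \<rho> (First a) y (s + 1)"
    by (rule evaluatesI) (use le in \<open>simp add: algebra_simps\<close>)
  with Q show ?case by blast
next
  case (6 m P \<rho> a Q)
  from 6(1)[OF 6(2)[unfolded wp.simps]] obtain x s where x: "evaluates m P \<rho> a x s"
    and "on_pair x (\<lambda>y z. Q z (s + 1))" by blast
  then obtain y z where xyz: "x = Pr y z" and Q: "Q z (s + 1)"
    by (cases x) auto
  from x xyz obtain s' where "eval P \<rho> a (Pr y z) s'" and le: "s' \<le> s * (2 * m + 3)"
    by (auto simp: evaluates_def)
  from eval_Second[OF this(1)] have "evaluates m P \<rho> (Second a) z (s + 1)"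
    by (rule evaluatesI) (use le in \<open>simp add: algebra_simps\<close>)
  with Q show ?case by blast
next
  case (7 m P \<rho> a Q)
  from 7(1)[OF 7(2)[unfolded wp.simps]] obtain x s where x: "evaluates m P \<rho> a x s"
    and Q: "Q (Num (if is_pair x then 1 else 0)) (s + 1)" by blast
  from x obtain s' where s': "eval P \<rho> a x s'" and le: "s' \<le> s * (2 * m + 3)"
    by (auto simp: evaluates_def)
  have "eval P \<rho> (IsPair a) (Num (if is_pair x then 1 else 0)) (1 + s')"
    using s' by (cases x) (simp_all add: eval_IsPair_Pr[simplified] eval_IsPair_Num[simplified])
  then have "evaluates m P \<rho> (IsPair a) (Num (if is_pair x then 1 else 0)) (s + 1)"
    by (rule evaluatesI) (use le in \<open>simp add: algebra_simps\<close>)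
  with Q show ?case by blast
next
  case (8 m P \<rho> a b c Q)
  from 8(3)[OF 8(4)[unfolded wp.simps]] obtain x s where x: "evaluates m P \<rho> a x s"
    and "on_num x (\<lambda>i. if i = 0 then wp m P \<rho> c (\<lambda>y t. Q y (s + t + 1))
      else wp m P \<rho> b (\<lambda>y t. Q y (s + t + 1)))" by blast
  then obtain i where i: "x = Num i" and br: "if i = 0 then wp m P \<rho> c (\<lambda>y t. Q y (s + t + 1))
      else wp m P \<rho> b (\<lambda>y t. Q y (s + t + 1))"
    by (cases x) auto
  from x i obtain s' where s': "eval P \<rho> a (Num i) s'" and les: "s' \<le> s * (2 * m + 3)"
    by (auto simp: evaluates_def)
  show ?case
  proof (cases "i = 0")
    case True
    with br have "wp m P \<rho> c (\<lambda>y t. Q y (s + t + 1))" by simp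
    from 8(1)[OF True this] obtain y t where y: "evaluates m P \<rho> c y t" and Q: "Q y (s + t + 1)"
      by blast
    from y obtain t' where t': "eval P \<rho> c y t'" and let': "t' \<le> t * (2 * m + 3)"
      by (auto simp: evaluates_def)
    from eval_IfE_false[OF s'[unfolded True] t'] have "evaluates m P \<rho> (IfE a b c) y (s + t + 1)"
      by (rule evaluatesI) (use les let' in \<open>simp add: algebra_simps\<close>)
    with Q show ?thesis by blast
  next
    case False
    with br have "wp m P \<rho> b (\<lambda>y t. Q y (s + t + 1))" by simp
    from 8(2)[OF False this] obtain y t where y: "evaluates m P \<rho> b y t" and Q: "Q y (s + t + 1)"
      by blast
    from y obtain t' where t': "eval P \<rho> b y t'" and let': "t' \<le> t * (2 * m + 3)"
      by (auto simp: evaluates_def)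
    from eval_IfE_true[OF s' False t'] have "evaluates m P \<rho> (IfE a b c) y (s + t + 1)"
      by (rule evaluatesI) (use les let' in \<open>simp add: algebra_simps\<close>)
    with Q show ?thesis by blast
  qed
next
  case (9 m P \<rho> a b Q)
  from 9(2)[OF 9(3)[unfolded wp.simps]] obtain x s where x: "evaluates m P \<rho> a x s"
    and "wp m P (x # \<rho>) b (\<lambda>y t. Q y (s + t + 1))" by blast
  from 9(1)[OF this(2)] obtain y t where y: "evaluates m P (x # \<rho>) b y t" and Q: "Q y (s + t + 1)"
    by blast
  from x y obtain s' t' where "eval P \<rho> a x s'" "eval P (x # \<rho>) b y t'"
    and le: "s' \<le> s * (2 * m + 3)" "t' \<le> t * (2 * m + 3)"
    by (auto simp: evaluates_def)
  from eval_LetE[OF this(1,2)] have "evaluates m P \<rho> (LetE a b) y (s + t + 1)"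
    by (rule evaluatesI) (use le in \<open>simp add: algebra_simps\<close>)
  with Q show ?case by blast
next
  case (10 m P \<rho> f as Q)
  from 10(1)[OF 10(2)[unfolded wp.simps]] obtain xs s where xs: "evaluates_list m P \<rho> as xs s"
    and "call m P f xs (\<lambda>y t. Q y (s + t + 1))" by blast
  then obtain y t where f: "f < length P" and y: "evaluates m P xs (P ! f) y t" and Q: "Q y (s + t + 1)"
    by (auto simp: call_def runs_def)
  from xs y obtain s' t' where "eval_list P \<rho> as xs s'" "eval P xs (P ! f) y t'"
    and le: "s' \<le> s * (2 * m + 3)" "t' \<le> t * (2 * m + 3)"
    by (auto simp: evaluates_def evaluates_list_def)
  from eval_Call[OF f this(1,2)] have "evaluates m P \<rho> (Call f as) y (s + t + 1)"
    by (rule evaluatesI) (use le in \<open>simp add: algebra_simps\<close>)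
  with Q show ?case by blast
next
  case (11 m P \<rho> Q)
  then show ?case
    by (intro exI[of _ "[]"] exI[of _ 0]) (auto simp: evaluates_list_def intro!: exI eval_list_Nil)
next
  case (12 m P \<rho> a as Q)
  from 12(2)[OF 12(3)[unfolded wps.simps]] obtain x s where x: "evaluates m P \<rho> a x s"
    and "wps m P \<rho> as (\<lambda>xs t. Q (x # xs) (s + t))" by blast
  from 12(1)[OF this(2)] obtain xs t where xs: "evaluates_list m P \<rho> as xs t" and Q: "Q (x # xs) (s + t)"
    by blast
  from x xs obtain s' t' where "eval P \<rho> a x s'" "eval_list P \<rho> as xs t'"
    and le: "s' \<le> s * (2 * m + 3)" "t' \<le> t * (2 * m + 3)"
    by (auto simp: evaluates_def evaluates_list_def)
  from eval_list_Cons[OF this(1,2)] have "evaluates_list m P \<rho> (a # as) (x # xs) (s + t)"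
    unfolding evaluates_list_def using le by (auto simp: algebra_simps intro!: exI)
  with Q show ?case by blast
qed

lemma runsI:
  assumes "f < length P" "wp m P xs (P ! f) (\<lambda>y k. y = x \<and> k \<le> K)"
  shows "runs m P f xs x K"
proof -
  from wp_sound(1)[OF assms(2)] obtain k where "evaluates m P xs (P ! f) x k" "k \<le> K"
    by blast
  then have "evaluates m P xs (P ! f) x K"
    unfolding evaluates_def by (meson mult_le_mono1 order_trans)
  with assms(1) show ?thesis by (simp add: runs_def)
qed

lemma callI: "runs m P f xs y k \<Longrightarrow> Q y k \<Longrightarrow> call m P f xs Q"
  by (auto simp: call_def)

lemma runs_mono: "runs m P f xs x k \<Longrightarrow> k \<le> K \<Longrightarrow> runs m P f xs x K"
  unfolding runs_def evaluates_def by (meson mult_le_mono1 order_trans)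

section \<open>The local search program\<close>

definition main_fn :: nat where "main_fn = 0"
definition append_fn :: nat where "append_fn = 1"
definition toggle_fn :: nat where "toggle_fn = 2"
definition degree_fn :: nat where "degree_fn = 3"
definition fits_fn :: nat where "fits_fn = 4"
definition rat_le_fn :: nat where "rat_le_fn = 5"
definition min_edge_fn :: nat where "min_edge_fn = 6"
definition max_budget_fn :: nat where "max_budget_fn = 7"
definition scale_fn :: nat where "scale_fn = 8"
definition total_fn :: nat where "total_fn = 9"
definition value_fn :: nat where "value_fn = 10"
definition better_fn :: nat where "better_fn = 11"
definition best_fn :: nat where "best_fn = 12"
definition search_fn :: nat where "search_fn = 13"
definition iterate_fn :: nat where "iterate_fn = 14"
definition prices_fn :: nat where "prices_fn = 15"
definition names_fn :: nat where "names_fn = 16"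
definition length_fn :: nat where "length_fn = 17"

abbreviation edge_left :: "expr \<Rightarrow> expr" where "edge_left a \<equiv> First (Second a)"
abbreviation edge_right :: "expr \<Rightarrow> expr" where "edge_right a \<equiv> First (Second (Second a))"
abbreviation edge_budget :: "expr \<Rightarrow> expr" where "edge_budget a \<equiv> Second (Second (Second a))"

definition main_body :: "nat \<Rightarrow> expr" where \<comment> \<open>arguments \<open>[instance]\<close>\<close>
  "main_body c =
  LetE (Call append_fn [First (Var 0), First (Second (Var 0))])
   (LetE (MkPair (Var 0) (MkPair (Second (Second (Var 1)))
       (MkPair (Call max_budget_fn [Var 0, Second (Second (Var 1))])
         (Op Mul (Lit (int c)) (Call length_fn [Second (Second (Var 1))])))))
     (LetE (Call iterate_fn [Lit 0, Var 0])
       (MkPair (Call prices_fn [Var 2, Var 0]) (Call names_fn [Var 0]))))"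

text \<open>
  An edge set is a list of encoded edges. The argument \<open>data\<close> is \<open>(ws, (es, (B, N)))\<close>: all vertices, all
  edges, the largest budget \<open>B\<close> of an edge that can be sold at all, and the number \<open>N\<close> to which \<open>B\<close> is
  scaled. An absent edge is \<open>Num 0\<close>, and the value of a set that violates a capacity is \<open>- 1\<close>.
\<close>

definition append_body :: "expr" where \<comment> \<open>arguments \<open>[xs, ys]\<close>\<close>
  "append_body =
  IfE (IsPair (Var 0)) (MkPair (First (Var 0)) (Call append_fn [Second (Var 0), Var 1])) (Var 1)"

definition toggle_body :: "expr" where \<comment> \<open>arguments \<open>[e, F]\<close>\<close>
  "toggle_body =
  IfE (IsPair (Var 1))
    (IfE (Op Sub (First (Var 0)) (First (First (Var 1))))
      (MkPair (First (Var 1)) (Call toggle_fn [Var 0, Second (Var 1)]))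
      (Second (Var 1)))
    (MkPair (Var 0) (Lit 0))"

definition degree_body :: "expr" where \<comment> \<open>arguments \<open>[w, F]\<close>\<close>
  "degree_body =
  IfE (IsPair (Var 1))
    (Op Add (Call degree_fn [Var 0, Second (Var 1)])
      (IfE (Op Sub (edge_left (First (Var 1))) (Var 0))
        (IfE (Op Sub (edge_right (First (Var 1))) (Var 0)) (Lit 0) (Lit 1)) (Lit 1)))
    (Lit 0)"

definition fits_body :: "expr" where \<comment> \<open>arguments \<open>[ws, F]\<close>\<close>
  "fits_body =
  IfE (IsPair (Var 0))
    (IfE (IfE (Op Add (Second (First (Var 0))) (Lit 1))
           (Op Leq (Call degree_fn [First (First (Var 0)), Var 1]) (Second (First (Var 0)))) (Lit 1))
      (Call fits_fn [Second (Var 0), Var 1]) (Lit 0))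
    (Lit 1)"

definition rat_le_body :: "expr" where \<comment> \<open>arguments \<open>[r, s]\<close>\<close>
  "rat_le_body =
  Op Leq (Op Mul (First (Var 0)) (Second (Var 1))) (Op Mul (First (Var 1)) (Second (Var 0)))"

definition min_edge_body :: "expr" where \<comment> \<open>arguments \<open>[w, F]\<close>\<close>
  "min_edge_body =
  IfE (IsPair (Var 1))
    (LetE (Call min_edge_fn [Var 0, Second (Var 1)])
      (IfE (Op Sub (edge_left (First (Var 2))) (Var 1)) (Var 0)
        (IfE (IsPair (Var 0))
          (IfE (Call rat_le_fn [edge_budget (First (Var 2)), edge_budget (Var 0)])
            (First (Var 2)) (Var 0))
          (First (Var 2)))))
    (Lit 0)"

definition max_budget_body :: "expr" where \<comment> \<open>arguments \<open>[ws, es]\<close>\<close>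
  "max_budget_body =
  IfE (IsPair (Var 1))
    (LetE (Call max_budget_fn [Var 0, Second (Var 1)])
      (IfE (Call fits_fn [Var 1, MkPair (First (Var 2)) (Lit 0)])
        (IfE (Call rat_le_fn [Var 0, edge_budget (First (Var 2))])
          (edge_budget (First (Var 2))) (Var 0))
        (Var 0)))
    (MkPair (Lit 0) (Lit 1))"

definition scale_body :: "expr" where \<comment> \<open>arguments \<open>[r, data]\<close>\<close>
  "scale_body =
  Op Div (Op Mul (Op Mul (First (Var 0)) (Second (Second (Second (Var 1)))))
      (Second (First (Second (Second (Var 1))))))
    (Op Mul (Second (Var 0)) (First (First (Second (Second (Var 1))))))"

definition total_body :: "expr" where \<comment> \<open>arguments \<open>[ws, F, data]\<close>\<close>
  "total_body =
  IfE (IsPair (Var 0))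
    (Op Add (Call total_fn [Second (Var 0), Var 1, Var 2])
      (LetE (Call min_edge_fn [First (First (Var 0)), Var 1])
        (IfE (IsPair (Var 0))
          (Op Mul (Call degree_fn [First (First (Var 1)), Var 2])
            (Call scale_fn [edge_budget (Var 0), Var 3]))
          (Lit 0))))
    (Lit 0)"

definition value_body :: "expr" where \<comment> \<open>arguments \<open>[F, data]\<close>\<close>
  "value_body =
  IfE (Call fits_fn [First (Var 1), Var 0]) (Call total_fn [First (Var 1), Var 0, Var 1]) (Lit (- 1))"

definition better_body :: "expr" where \<comment> \<open>arguments \<open>[F, G, data]\<close>\<close>
  "better_body =
  IfE (Op Leq (Call value_fn [Var 1, Var 2]) (Call value_fn [Var 0, Var 2])) (Var 0) (Var 1)"

definition best_body :: "expr" where \<comment> \<open>arguments \<open>[k, F, data]\<close>\<close>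
  "best_body =
  IfE (Var 0) (Call search_fn [Var 0, Var 1, First (Second (Var 2)), Var 2]) (Var 1)"

definition search_body :: "expr" where \<comment> \<open>arguments \<open>[k, F, es, data]\<close>\<close>
  "search_body =
  IfE (IsPair (Var 2))
    (Call better_fn
      [Call best_fn [Op Sub (Var 0) (Lit 1), Call toggle_fn [First (Var 2), Var 1], Var 3],
       Call search_fn [Var 0, Var 1, Second (Var 2), Var 3], Var 3])
    (Call best_fn [Op Sub (Var 0) (Lit 1), Var 1, Var 3])"

definition iterate_body :: "nat \<Rightarrow> expr" where \<comment> \<open>arguments \<open>[F, data]\<close>\<close>
  "iterate_body K =
  LetE (Call best_fn [Lit (int K), Var 0, Var 1])
    (IfE (Op Leq (Call value_fn [Var 0, Var 2]) (Call value_fn [Var 1, Var 2])) (Var 1)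
      (Call iterate_fn [Var 0, Var 2]))"

definition prices_body :: "expr" where \<comment> \<open>arguments \<open>[ws, F]\<close>\<close>
  "prices_body =
  IfE (IsPair (Var 0))
    (MkPair
      (MkPair (First (First (Var 0)))
        (LetE (Call min_edge_fn [First (First (Var 0)), Var 1])
          (IfE (IsPair (Var 0)) (edge_budget (Var 0)) (MkPair (Lit 0) (Lit 1)))))
      (Call prices_fn [Second (Var 0), Var 1]))
    (Lit 0)"

definition names_body :: "expr" where \<comment> \<open>arguments \<open>[F]\<close>\<close>
  "names_body =
  IfE (IsPair (Var 0)) (MkPair (First (First (Var 0))) (Call names_fn [Second (Var 0)])) (Lit 0)"

definition length_body :: "expr" where \<comment> \<open>arguments \<open>[es]\<close>\<close>
  "length_body =
  IfE (IsPair (Var 0)) (Op Add (Call length_fn [Second (Var 0)]) (Lit 1)) (Lit 0)"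

text \<open>The size \<open>K\<close> of a move and the precision \<open>c\<close> enter as
  literals. Names are compared by subtraction: a nonzero difference, which counts as true, means
  that they differ.\<close>

definition pricing_program :: "nat \<Rightarrow> nat \<Rightarrow> program" where
  "pricing_program K c =
     [main_body c, append_body, toggle_body, degree_body, fits_body, rat_le_body,
      min_edge_body, max_budget_body, scale_body, total_body, value_body, better_body,
      best_body, search_body, iterate_body K, prices_body, names_body, length_body]"

lemmas fn_defs = main_fn_def append_fn_def toggle_fn_def degree_fn_def fits_fn_def rat_le_fn_def
  min_edge_fn_def max_budget_fn_def scale_fn_def total_fn_def value_fn_def better_fn_def best_fn_def
  search_fn_def iterate_fn_def prices_fn_def names_fn_def length_fn_def

lemma length_pricing_program:
  "main_fn < length (pricing_program K c)"
  "append_fn < length (pricing_program K c)"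
  "toggle_fn < length (pricing_program K c)"
  "degree_fn < length (pricing_program K c)"
  "fits_fn < length (pricing_program K c)"
  "rat_le_fn < length (pricing_program K c)"
  "min_edge_fn < length (pricing_program K c)"
  "max_budget_fn < length (pricing_program K c)"
  "scale_fn < length (pricing_program K c)"
  "total_fn < length (pricing_program K c)"
  "value_fn < length (pricing_program K c)"
  "better_fn < length (pricing_program K c)"
  "best_fn < length (pricing_program K c)"
  "search_fn < length (pricing_program K c)"
  "iterate_fn < length (pricing_program K c)"
  "prices_fn < length (pricing_program K c)"
  "names_fn < length (pricing_program K c)"
  "length_fn < length (pricing_program K c)"
  by (simp_all add: pricing_program_def fn_defs)

lemma pricing_program_nth:
  "pricing_program K c ! main_fn = main_body c"
  "pricing_program K c ! append_fn = append_body"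
  "pricing_program K c ! toggle_fn = toggle_body"
  "pricing_program K c ! degree_fn = degree_body"
  "pricing_program K c ! fits_fn = fits_body"
  "pricing_program K c ! rat_le_fn = rat_le_body"
  "pricing_program K c ! min_edge_fn = min_edge_body"
  "pricing_program K c ! max_budget_fn = max_budget_body"
  "pricing_program K c ! scale_fn = scale_body"
  "pricing_program K c ! total_fn = total_body"
  "pricing_program K c ! value_fn = value_body"
  "pricing_program K c ! better_fn = better_body"
  "pricing_program K c ! best_fn = best_body"
  "pricing_program K c ! search_fn = search_body"
  "pricing_program K c ! iterate_fn = iterate_body K"
  "pricing_program K c ! prices_fn = prices_body"
  "pricing_program K c ! names_fn = names_body"
  "pricing_program K c ! length_fn = length_body"
  by (simp_all add: pricing_program_def fn_defs)

subsection \<open>Results and costs of the functions\<close>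

lemma on_pair_enc [simp]:
  "on_pair (enc_edge I e) R = R (Num (int e))
    (Pr (Num (int (left_end I e))) (Pr (Num (int (right_end I e))) (enc_rat (budget I e))))"
  "on_pair (enc_vertex I w) R = R (Num (int w)) (enc_capacity (capacity I w))"
  "on_pair (enc_rat r) R = R (Num (fst (quotient_of r))) (Num (snd (quotient_of r)))"
  by (simp_all add: enc_edge_def enc_vertex_def enc_rat_def enc_nat_def split: prod.split)

lemma is_pair_enc_edge [simp]: "is_pair (enc_edge I e)"
  by (simp add: enc_edge_def)

lemma on_num_enc_capacity [simp]:
  "on_num (enc_capacity c) R = R (case c of enat n \<Rightarrow> int n | \<infinity> \<Rightarrow> - 1)"
  by (cases c) (simp_all add: enc_capacity_def enc_nat_def)

section \<open>Functional counterparts of the program\<close>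

definition degree_in :: "(nat, nat) pricing \<Rightarrow> nat list \<Rightarrow> nat \<Rightarrow> nat" where
  "degree_in I gs w = length (filter (\<lambda>e. left_end I e = w \<or> right_end I e = w) gs)"

definition fits :: "(nat, nat) pricing \<Rightarrow> nat list \<Rightarrow> nat list \<Rightarrow> bool" where
  "fits I ws gs \<longleftrightarrow> (\<forall>w\<in>set ws. enat (degree_in I gs w) \<le> capacity I w)"

lemma fits_simps [simp]:
  "fits I [] gs"
  "fits I (w # ws) gs \<longleftrightarrow> enat (degree_in I gs w) \<le> capacity I w \<and> fits I ws gs"
  by (auto simp: fits_def)

fun toggle :: "nat \<Rightarrow> nat list \<Rightarrow> nat list" where
  "toggle e [] = [e]"
| "toggle e (g # gs) = (if e = g then gs else g # toggle e gs)"

fun min_edge :: "(nat, nat) pricing \<Rightarrow> nat list \<Rightarrow> nat \<Rightarrow> nat option" where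
  "min_edge I [] w = None"
| "min_edge I (g # gs) w = (if left_end I g = w
     then case min_edge I gs w of None \<Rightarrow> Some g
       | Some f \<Rightarrow> if budget I g \<le> budget I f then Some g else Some f
     else min_edge I gs w)"

text \<open>Edges that violate a capacity even when sold alone are skipped, since their budgets bear
  no relation to the optimum.\<close>

fun max_budget :: "(nat, nat) pricing \<Rightarrow> nat list \<Rightarrow> nat list \<Rightarrow> rat" where
  "max_budget I ws [] = 0"
| "max_budget I ws (e # es) = (let m = max_budget I ws es in
     if fits I ws [e] \<and> m \<le> budget I e then budget I e else m)"

text \<open>The floor of \<open>r * N / B\<close>, computed on numerators and denominators. For
  \<open>B = 0\<close> the divisor is 0, and so is the result.\<close>

definition scale :: "rat \<Rightarrow> int \<Rightarrow> rat \<Rightarrow> int" where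
  "scale B N r = (fst (quotient_of r) * N * snd (quotient_of B)) div
     (snd (quotient_of r) * fst (quotient_of B))"

text \<open>The cheapest edge is found by exact budgets; \<open>scale\<close> is monotone for
  nonnegative \<open>N\<close> and \<open>B\<close>, so this edge also has the least scaled
  budget.\<close>

definition scaled_revenue :: "(nat, nat) pricing \<Rightarrow> rat \<Rightarrow> int \<Rightarrow> nat list \<Rightarrow> nat \<Rightarrow> int" where
  "scaled_revenue I B N gs w = (case min_edge I gs w of None \<Rightarrow> 0
     | Some e \<Rightarrow> int (degree_in I gs w) * scale B N (budget I e))"

definition valuation :: "(nat, nat) pricing \<Rightarrow> nat list \<Rightarrow> rat \<Rightarrow> int \<Rightarrow> nat list \<Rightarrow> int" where
  "valuation I ws B N gs = (if fits I ws gs then \<Sum>w\<leftarrow>ws. scaled_revenue I B N gs w else - 1)"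

text \<open>An exhaustive search over sequences of at most \<open>k\<close> toggles that keeps the
  most valuable outcome. The end of the edge list spends one unit of fuel without toggling, so
  shorter sequences are covered too.\<close>

fun best :: "(nat list \<Rightarrow> int) \<Rightarrow> nat list \<Rightarrow> nat \<Rightarrow> nat list \<Rightarrow> nat list"
  and search :: "(nat list \<Rightarrow> int) \<Rightarrow> nat list \<Rightarrow> nat \<Rightarrow> nat list \<Rightarrow> nat list \<Rightarrow> nat list" where
  "best \<nu> es 0 gs = gs"
| "best \<nu> es (Suc k) gs = search \<nu> es k gs es"
| "search \<nu> es k gs [] = best \<nu> es k gs"
| "search \<nu> es k gs (e # fs) = (let x = best \<nu> es k (toggle e gs); y = search \<nu> es k gs fs
     in if \<nu> y \<le> \<nu> x then x else y)"

lemma toggle_distinct: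
  "distinct gs \<Longrightarrow> distinct (toggle e gs) \<and> set (toggle e gs) = (if e \<in> set gs then set gs - {e} else insert e (set gs))"
  by (induction gs) auto

lemma degree_in_le: "degree_in I gs w \<le> length gs"
  by (simp add: degree_in_def)

lemma abs_mult_less_power:
  fixes a b :: int
  assumes "\<bar>a\<bar> < 2 ^ x" "\<bar>b\<bar> < 2 ^ y"
  shows "\<bar>a * b\<bar> < 2 ^ (x + y)"
  using mult_strict_mono'[OF assms] by (simp add: abs_mult power_add)

locale encoded_instance =
  fixes I :: "(nat, nat) pricing" and V es :: "nat list" and s K c :: nat
  assumes vertex_small: "w \<in> set V \<Longrightarrow> w < 2 ^ s"
    and capacity_small: "w \<in> set V \<Longrightarrow> capacity I w = enat n \<Longrightarrow> n < 2 ^ s"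
    and edge_small: "e \<in> set es \<Longrightarrow> e < 2 ^ s"
      "e \<in> set es \<Longrightarrow> left_end I e < 2 ^ s" "e \<in> set es \<Longrightarrow> right_end I e < 2 ^ s"
      "e \<in> set es \<Longrightarrow> \<bar>fst (quotient_of (budget I e))\<bar> < 2 ^ s"
      "e \<in> set es \<Longrightarrow> snd (quotient_of (budget I e)) < 2 ^ s"
    and budget_nonneg: "e \<in> set es \<Longrightarrow> 0 \<le> budget I e"
    and s_pos: "1 \<le> s"
    and length_small: "length V < 2 ^ s" "length es < 2 ^ s"
begin

text \<open>A bit bound for all operands: \<open>3 * s + c\<close> for a scaled budget,
  \<open>s\<close> more for its multiplication by a degree, and \<open>s\<close> more for the sum
  over all vertices; \<open>K\<close> accommodates the fuel.\<close>

definition m :: nat where "m = 5 * s + c + K + 5"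

abbreviation "P \<equiv> pricing_program K c"
abbreviation "elist gs \<equiv> enc_list (map (enc_edge I) gs)"
abbreviation "vlist ws \<equiv> enc_list (map (enc_vertex I) ws)"
abbreviation "data B N \<equiv> Pr (vlist V) (Pr (elist es) (Pr (enc_rat B) (Num N)))"

lemma small: "\<bar>i\<bar> < 2 ^ k \<Longrightarrow> k \<le> m \<Longrightarrow> \<bar>i\<bar> < (2::int) ^ m"
  by (meson less_le_trans one_le_numeral power_increasing)

lemma s_le_m: "s \<le> m" by (simp add: m_def)

lemma small_numbers [simp]: "(1::int) < 2 ^ m" "(0::int) < 2 ^ m"
  by (auto simp: m_def one_less_power)

lemma small_nat [simp]: "n < 2 ^ s \<Longrightarrow> n < (2::nat) ^ m"
  using s_le_m by (meson less_le_trans one_le_numeral power_increasing)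

lemmas program_simps = length_pricing_program pricing_program_nth

lemma runs_append:
  "runs m P append_fn [enc_list xs, enc_list ys] (enc_list (xs @ ys)) (20 * (length xs + 1))"
proof (induction xs)
  case Nil
  show ?case by (rule runsI) (simp_all add: program_simps append_body_def)
next
  case (Cons x xs)
  show ?case by (rule runsI) (auto simp: program_simps append_body_def intro!: callI[OF Cons.IH])
qed

lemma runs_toggle:
  "e \<in> set es \<Longrightarrow> set gs \<subseteq> set es \<Longrightarrow>
    runs m P toggle_fn [enc_edge I e, elist gs] (elist (toggle e gs)) (20 * (length gs + 1))"
proof (induction gs)
  case Nil
  show ?case by (rule runsI) (simp_all add: program_simps toggle_body_def)
next
  case (Cons g gs)
  show ?case
    by (rule runsI) (use Cons.prems edge_small in \<open>auto simp: program_simps toggle_body_def intro!: callI[OF Cons.IH]\<close>)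
qed

lemma runs_degree:
  "w < 2 ^ s \<Longrightarrow> set gs \<subseteq> set es \<Longrightarrow> length gs < 2 ^ s \<Longrightarrow>
    runs m P degree_fn [Num (int w), elist gs] (Num (int (degree_in I gs w))) (40 * (length gs + 1))"
proof (induction gs)
  case Nil
  show ?case by (rule runsI) (simp_all add: program_simps degree_body_def degree_in_def)
next
  case (Cons g gs)
  have less: "degree_in I gs w < 2 ^ s"
    using degree_in_le[of I gs w] Cons.prems(3) by simp
  have IH: "runs m P degree_fn [Num (int w), elist gs] (Num (int (degree_in I gs w))) (40 * (length gs + 1))"
    using Cons by simp
  show ?case
    by (rule runsI; (simp add: program_simps degree_body_def split del: if_split)?; (rule callI[OF IH])?;
      use Cons.prems edge_small less in \<open>auto simp: degree_in_def\<close>)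
qed

lemma runs_fits:
  assumes "set gs \<subseteq> set es" "length gs \<le> length es"
  shows "set ws \<subseteq> set V \<Longrightarrow>
    runs m P fits_fn [vlist ws, elist gs] (Num (if fits I ws gs then 1 else 0)) (60 * (length gs + 2) * (length ws + 1))"
proof (induction ws)
  case Nil
  show ?case by (rule runsI) (simp_all add: program_simps fits_body_def)
next
  case (Cons w ws)
  have len: "length gs < 2 ^ s"
    using assms(2) length_small by linarith
  have "degree_in I gs w < 2 ^ s"
    using degree_in_le[of I gs w] len by simp
  then show ?case
    by (intro runsI) (use Cons.prems vertex_small capacity_small len in \<open>auto simp: program_simps fits_body_def split: enat.split
      intro!: callI[OF Cons.IH] callI[OF runs_degree] assms\<close>)
qed

lemma runs_rat_le:
  assumes "\<bar>fst (quotient_of x)\<bar> < 2 ^ s" "snd (quotient_of x) < 2 ^ s"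
    "\<bar>fst (quotient_of y)\<bar> < 2 ^ s" "snd (quotient_of y) < 2 ^ s"
  shows "runs m P rat_le_fn [enc_rat x, enc_rat y] (Num (if x \<le> y then 1 else 0)) 20"
proof -
  have pos: "0 < snd (quotient_of r)" for r
    using quotient_of_denom_pos' by blast
  have "\<bar>fst (quotient_of x) * snd (quotient_of y)\<bar> < 2 ^ m" "\<bar>fst (quotient_of y) * snd (quotient_of x)\<bar> < 2 ^ m"
    using assms pos[of x] pos[of y] by (intro small[OF abs_mult_less_power[of _ s _ s]]; simp add: m_def)+
  moreover have "\<bar>fst (quotient_of r)\<bar> < 2 ^ m \<and> \<bar>snd (quotient_of r)\<bar> < 2 ^ m"
    if "\<bar>fst (quotient_of r)\<bar> < 2 ^ s" "snd (quotient_of r) < 2 ^ s" for r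
    using that pos[of r] small[of "fst (quotient_of r)" s] small[of "snd (quotient_of r)" s] s_le_m by auto
  ultimately show ?thesis
    by (intro runsI) (use assms in \<open>simp_all add: program_simps rat_le_body_def rat_less_eq_code case_prod_beta mult.commute\<close>)
qed

definition small_rat :: "rat \<Rightarrow> bool" where
  "small_rat r \<longleftrightarrow> \<bar>fst (quotient_of r)\<bar> < 2 ^ s \<and> snd (quotient_of r) < 2 ^ s"

lemma small_rat_budget: "e \<in> set es \<Longrightarrow> small_rat (budget I e)"
  using edge_small by (simp add: small_rat_def)

lemma min_edge_SomeD: "min_edge I gs w = Some e \<Longrightarrow> e \<in> set gs \<and> left_end I e = w"
  by (induction gs arbitrary: e) (auto split: if_splits option.splits)

lemma runs_min_edge:
  "w < 2 ^ s \<Longrightarrow> set gs \<subseteq> set es \<Longrightarrow>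
    runs m P min_edge_fn [Num (int w), elist gs]
      (case min_edge I gs w of None \<Rightarrow> Num 0 | Some e \<Rightarrow> enc_edge I e) (80 * (length gs + 1))"
proof (induction gs)
  case Nil
  show ?case by (rule runsI) (simp_all add: program_simps min_edge_body_def)
next
  case (Cons g gs)
  have IH: "runs m P min_edge_fn [Num (int w), elist gs]
      (case min_edge I gs w of None \<Rightarrow> Num 0 | Some e \<Rightarrow> enc_edge I e) (80 * (length gs + 1))"
    using Cons by simp
  show ?case
  proof (cases "min_edge I gs w")
    case None
    then show ?thesis
      by (intro runsI; (simp add: program_simps min_edge_body_def split del: if_split)?; (intro callI[OF IH])?;
        use Cons.prems edge_small None in auto)
  next
    case (Some f)
    then have "f \<in> set es"
      using min_edge_SomeD Cons.prems by fastforce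
    then have le: "runs m P rat_le_fn [enc_rat (budget I g), enc_rat (budget I f)]
        (Num (if budget I g \<le> budget I f then 1 else 0)) 20"
      using Cons.prems edge_small by (intro runs_rat_le) auto
    show ?thesis
      by (intro runsI; (simp add: program_simps min_edge_body_def split del: if_split)?; (intro callI[OF IH])?;
        use Cons.prems edge_small Some in \<open>auto intro!: callI[OF le]\<close>)
  qed
qed

lemma small_rat_max_budget:
  "set fs \<subseteq> set es \<Longrightarrow> small_rat (max_budget I V fs)"
  using s_pos one_less_power[of "2::int" s]
  by (induction fs) (auto simp: small_rat_budget Let_def, simp add: small_rat_def rat_zero_code)

lemma runs_max_budget:
  "set fs \<subseteq> set es \<Longrightarrow>
    runs m P max_budget_fn [vlist V, elist fs] (enc_rat (max_budget I V fs))
      (300 * (length V + 1) * (length fs + 1))"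
proof (induction fs)
  case Nil
  show ?case by (rule runsI) (simp_all add: program_simps max_budget_body_def enc_rat_def rat_zero_code)
next
  case (Cons g gs)
  have IH: "runs m P max_budget_fn [vlist V, elist gs] (enc_rat (max_budget I V gs))
      (300 * (length V + 1) * (length gs + 1))"
    using Cons by simp
  have "1 \<le> length es"
    using Cons.prems by (cases es) auto
  then have fit: "runs m P fits_fn [vlist V, Pr (enc_edge I g) (Num 0)]
      (Num (if fits I V [g] then 1 else 0)) (180 * (length V + 1))"
    using runs_fits[of "[g]" V] Cons.prems by simp
  have le: "runs m P rat_le_fn [enc_rat (max_budget I V gs), enc_rat (budget I g)]
      (Num (if max_budget I V gs \<le> budget I g then 1 else 0)) 20"
    using Cons.prems edge_small small_rat_max_budget[of gs] by (intro runs_rat_le) (auto simp: small_rat_def)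
  show ?case
    by (rule runsI; (simp add: program_simps max_budget_body_def split del: if_split)?; (rule callI[OF IH])?;
      (simp add: Let_def split del: if_split)?; (rule callI[OF fit])?; auto intro!: callI[OF le])
qed

end

locale encoded_data = encoded_instance +
  fixes B :: rat and N :: int
  assumes B: "small_rat B" "0 \<le> B" and N: "0 \<le> N" "N < 2 ^ (s + c)"
begin

lemma quotient_nonneg: "0 \<le> r \<Longrightarrow> 0 \<le> fst (quotient_of r)"
  by (cases "quotient_of r") (use quotient_of_div[of r] quotient_of_denom_pos[of r] in \<open>auto simp: zero_le_divide_iff\<close>)

lemma scale_bounds:
  assumes "small_rat r" "0 \<le> r"
  shows "0 \<le> scale B N r" "scale B N r < 2 ^ (3 * s + c)"
proof -
  let ?a = "fst (quotient_of r) * N * snd (quotient_of B)" and ?b = "snd (quotient_of r) * fst (quotient_of B)"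
  have pos: "0 < snd (quotient_of q)" for q
    using quotient_of_denom_pos' by blast
  have a0: "0 \<le> ?a" and b0: "0 \<le> ?b"
    using quotient_nonneg[OF assms(2)] quotient_nonneg[OF B(2)] pos[of r] pos[of B] N by simp_all
  then show "0 \<le> scale B N r"
    by (simp add: scale_def pos_imp_zdiv_nonneg_iff div_int_pos_iff)
  have "\<bar>?a\<bar> < 2 ^ (s + (s + c) + s)"
    using assms(1) B(1) N pos[of B] by (intro abs_mult_less_power) (auto simp: small_rat_def)
  \<comment> \<open>The divisor is a nonnegative integer, and division by 0 gives 0.\<close>
  moreover have "scale B N r \<le> ?a"
    using zdiv_mono2[of ?a 1 ?b] a0 b0 unfolding scale_def by (cases "?b = 0") auto
  moreover have "s + (s + c) + s = 3 * s + c"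
    by simp
  ultimately show "scale B N r < 2 ^ (3 * s + c)"
    by (metis abs_ge_self le_less_trans)
qed

lemma runs_scale:
  assumes "small_rat r"
  shows "runs m P scale_fn [enc_rat r, data B N] (Num (scale B N r)) 60"
proof -
  have pos: "0 < snd (quotient_of q)" for q
    using quotient_of_denom_pos' by blast
  have 1: "\<bar>fst (quotient_of r) * N\<bar> < 2 ^ (s + (s + c))"
    using assms N by (intro abs_mult_less_power) (auto simp: small_rat_def)
  have 2: "\<bar>fst (quotient_of r) * N * snd (quotient_of B)\<bar> < 2 ^ (s + (s + c) + s)"
    using B(1) pos[of B] by (intro abs_mult_less_power 1) (auto simp: small_rat_def)
  have 3: "\<bar>snd (quotient_of r) * fst (quotient_of B)\<bar> < 2 ^ (s + s)"
    using assms B(1) pos[of r] by (intro abs_mult_less_power) (auto simp: small_rat_def)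
  have bounds: "\<bar>fst (quotient_of r) * N\<bar> < 2 ^ m" "\<bar>fst (quotient_of r) * N * snd (quotient_of B)\<bar> < 2 ^ m"
    "\<bar>snd (quotient_of r) * fst (quotient_of B)\<bar> < 2 ^ m" "\<bar>N\<bar> < 2 ^ m"
    "\<bar>fst (quotient_of r)\<bar> < 2 ^ m" "\<bar>snd (quotient_of r)\<bar> < 2 ^ m"
    "\<bar>fst (quotient_of B)\<bar> < 2 ^ m" "\<bar>snd (quotient_of B)\<bar> < 2 ^ m"
    using small[OF 1] small[OF 2] small[OF 3] N small[of N "s + c"] assms B(1) pos[of r] pos[of B]
      small[of "fst (quotient_of r)" s] small[of "snd (quotient_of r)" s]
      small[of "fst (quotient_of B)" s] small[of "snd (quotient_of B)" s]
    by (simp_all add: m_def small_rat_def)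
  show ?thesis
    by (rule runsI) (simp_all add: program_simps scale_body_def scale_def bounds)
qed

lemma scaled_revenue_bounds:
  assumes "set gs \<subseteq> set es" "length gs \<le> length es"
  shows "0 \<le> scaled_revenue I B N gs w" "scaled_revenue I B N gs w < 2 ^ (4 * s + c)"
proof -
  have "0 \<le> scaled_revenue I B N gs w \<and> scaled_revenue I B N gs w < 2 ^ (4 * s + c)"
  proof (cases "min_edge I gs w")
    case None
    then show ?thesis by (simp add: scaled_revenue_def)
  next
    case (Some e)
    then have e: "e \<in> set es" using min_edge_SomeD assms by blast
    note sc = scale_bounds[OF small_rat_budget[OF e] budget_nonneg[OF e]]
    have "degree_in I gs w < 2 ^ s"
      using degree_in_le[of I gs w] assms(2) length_small by linarith
    then have "\<bar>int (degree_in I gs w) * scale B N (budget I e)\<bar> < 2 ^ (s + (3 * s + c))"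
      using sc by (intro abs_mult_less_power) auto
    then show ?thesis
      using Some sc by (simp add: scaled_revenue_def)
  qed
  then show "0 \<le> scaled_revenue I B N gs w" "scaled_revenue I B N gs w < 2 ^ (4 * s + c)"
    by simp_all
qed

lemma total_bounds:
  assumes "set gs \<subseteq> set es" "length gs \<le> length es" "length ws \<le> length V"
  shows "0 \<le> (\<Sum>w\<leftarrow>ws. scaled_revenue I B N gs w)" "\<bar>\<Sum>w\<leftarrow>ws. scaled_revenue I B N gs w\<bar> < 2 ^ m"
proof -
  show nn: "0 \<le> (\<Sum>w\<leftarrow>ws. scaled_revenue I B N gs w)"
    using scaled_revenue_bounds(1)[OF assms(1,2)] by (intro sum_list_nonneg) auto
  have "(\<Sum>w\<leftarrow>ws. scaled_revenue I B N gs w) \<le> (\<Sum>w\<leftarrow>ws. 2 ^ (4 * s + c))"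
    using scaled_revenue_bounds(2)[OF assms(1,2)] by (intro sum_list_mono) (simp add: less_imp_le)
  also have "\<dots> = int (length ws) * 2 ^ (4 * s + c)"
    by (simp add: sum_list_triv)
  also have "\<dots> < 2 ^ s * 2 ^ (4 * s + c)"
    using assms(3) length_small(1) by (intro mult_strict_right_mono) auto
  also have "\<dots> \<le> 2 ^ m"
    by (simp add: m_def power_add[symmetric])
  finally show "\<bar>\<Sum>w\<leftarrow>ws. scaled_revenue I B N gs w\<bar> < 2 ^ m"
    using nn by simp
qed

lemma runs_total:
  assumes gs: "set gs \<subseteq> set es" "length gs \<le> length es"
  shows "set ws \<subseteq> set V \<Longrightarrow> length ws \<le> length V \<Longrightarrow>
    runs m P total_fn [vlist ws, elist gs, data B N] (Num (\<Sum>w\<leftarrow>ws. scaled_revenue I B N gs w))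
      (300 * (length gs + 1) * (length ws + 1))"
proof (induction ws)
  case Nil
  show ?case by (rule runsI) (simp_all add: program_simps total_body_def)
next
  case (Cons w ws)
  have IH: "runs m P total_fn [vlist ws, elist gs, data B N] (Num (\<Sum>w\<leftarrow>ws. scaled_revenue I B N gs w))
      (300 * (length gs + 1) * (length ws + 1))"
    using Cons by simp
  have w: "w < 2 ^ s" using vertex_small Cons.prems by simp
  have len: "length gs < 2 ^ s" using gs(2) length_small by linarith
  note me = runs_min_edge[OF w gs(1)]
  note tot = total_bounds[OF gs, of ws]
  have sr: "\<bar>scaled_revenue I B N gs w\<bar> < 2 ^ m"
    using scaled_revenue_bounds[OF gs, of w] small[of "scaled_revenue I B N gs w" "4 * s + c"] by (simp add: m_def)
  show ?case
  proof (cases "min_edge I gs w")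
    case None
    then have "scaled_revenue I B N gs w = 0" by (simp add: scaled_revenue_def)
    with None show ?thesis
      by (intro runsI; (simp add: program_simps total_body_def split del: if_split)?; (intro callI[OF IH])?; simp?;
        (intro callI[OF me])?; use tot Cons.prems in \<open>simp\<close>)
  next
    case (Some e)
    then have e: "e \<in> set es" using min_edge_SomeD gs by blast
    have "\<bar>scale B N (budget I e)\<bar> < 2 ^ m"
      using scale_bounds[OF small_rat_budget[OF e] budget_nonneg[OF e]]
      by (intro small[of _ "3 * s + c"]) (auto simp: m_def)
    moreover have "degree_in I gs w < 2 ^ m"
      using degree_in_le[of I gs w] len by (intro small_nat) simp
    moreover have "scaled_revenue I B N gs w = int (degree_in I gs w) * scale B N (budget I e)"
      using Some by (simp add: scaled_revenue_def)
    ultimately show ?thesis using Some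
      by (intro runsI; (simp add: program_simps total_body_def split del: if_split)?; (intro callI[OF IH])?; simp?;
        (intro callI[OF me])?; simp?; (intro callI[OF runs_degree[OF w gs(1) len]])?; simp?;
        (intro callI[OF runs_scale[OF small_rat_budget[OF e]]])?;
        use tot sr Cons.prems in \<open>simp\<close>)
  qed
qed

end

context encoded_data
begin

abbreviation "\<nu> \<equiv> valuation I V B N"

text \<open>Distinctness bounds the length by \<open>length es\<close>, hence the costs, and makes
  \<open>toggle\<close> a symmetric difference with one edge.\<close>

definition selection :: "nat list \<Rightarrow> bool" where
  "selection gs \<longleftrightarrow> distinct gs \<and> set gs \<subseteq> set es"

lemma selection_length: "selection gs \<Longrightarrow> length gs \<le> length es"
  by (metis selection_def List.finite_set card_mono card_length distinct_card order_trans)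

lemma selection_toggle: "selection gs \<Longrightarrow> e \<in> set es \<Longrightarrow> selection (toggle e gs)"
  using toggle_distinct[of gs e] by (auto simp: selection_def split: if_splits)

lemma selection_best:
  "es' = es \<Longrightarrow> selection gs \<Longrightarrow> selection (best f es' k gs)"
  "es' = es \<Longrightarrow> selection gs \<Longrightarrow> set fs \<subseteq> set es \<Longrightarrow> selection (search f es' k gs fs)"
  by (induction f es' k gs and f es' k gs fs rule: best_search.induct)
    (auto simp: Let_def selection_toggle)

definition W :: nat where "W = 1000 * (length es + 1) * (length V + 1)"

lemma W_ge: "1000 * (length es + 1) \<le> W" "1000 \<le> W"
  by (auto simp: W_def)

lemma valuation_small:
  assumes "selection gs"
  shows "\<bar>\<nu> gs\<bar> < 2 ^ m"
  using total_bounds(2)[of gs V] selection_length[OF assms] assms by (simp add: valuation_def selection_def)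

lemma runs_value:
  assumes gs: "selection gs"
  shows "runs m P value_fn [elist gs, data B N] (Num (\<nu> gs)) W"
proof -
  have g: "set gs \<subseteq> set es" "length gs \<le> length es"
    using gs selection_length by (auto simp: selection_def)
  define w where "w = (length es + 1) * (length V + 1)"
  have "60 * (length gs + 2) \<le> 120 * (length es + 1)"
    using g(2) by simp
  from mult_le_mono1[OF this] have "60 * (length gs + 2) * (length V + 1) \<le> 120 * w"
    unfolding w_def by (simp only: mult.assoc)
  from runs_mono[OF runs_fits[OF g subset_refl] this]
  have fit: "runs m P fits_fn [vlist V, elist gs] (Num (if fits I V gs then 1 else 0)) (120 * w)" .
  have "300 * (length gs + 1) \<le> 300 * (length es + 1)"
    using g(2) by simp
  from mult_le_mono1[OF this] have "300 * (length gs + 1) * (length V + 1) \<le> 300 * w"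
    unfolding w_def by (simp only: mult.assoc)
  from runs_mono[OF runs_total[OF g subset_refl order_refl] this]
  have tot: "runs m P total_fn [vlist V, elist gs, data B N] (Num (\<Sum>w\<leftarrow>V. scaled_revenue I B N gs w)) (300 * w)" .
  have w: "W = 1000 * w" "1 \<le> w"
    unfolding W_def w_def by (simp_all only: mult.assoc) simp
  show ?thesis
  proof (cases "fits I V gs")
    case True
    then show ?thesis
      by (intro runsI; (simp add: program_simps value_body_def)?; (intro callI[OF fit])?; simp?;
        (intro callI[OF tot])?; use w in \<open>simp add: valuation_def\<close>)
  next
    case False
    then show ?thesis
      by (intro runsI; (simp add: program_simps value_body_def)?; (intro callI[OF fit])?;
        use w in \<open>simp add: valuation_def\<close>)
  qed
qed

lemma toggle_time: "selection gs \<Longrightarrow> 20 * (length gs + 1) + 100 \<le> W"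
  using selection_length[of gs] W_ge by simp

lemma runs_better:
  assumes "selection fs" "selection gs"
  shows "runs m P better_fn [elist fs, elist gs, data B N] (elist (if \<nu> gs \<le> \<nu> fs then fs else gs)) (2 * W + 20)"
  by (rule runsI) (auto simp: program_simps better_body_def valuation_small[OF assms(1)] valuation_small[OF assms(2)]
      intro!: callI[OF runs_value[OF assms(1)]] callI[OF runs_value[OF assms(2)]])

text \<open>There is one branch per edge and one without a toggle, each with a recursive call, at
  most one toggle and at most one comparison of two values. The depth is the constant
  \<open>K\<close>, so the bound is polynomial.\<close>

fun best_time :: "nat \<Rightarrow> nat" where
  "best_time 0 = 10"
| "best_time (Suc k) = (length es + 1) * (best_time k + 4 * W) + 20"

lemma small_fuel: "k \<le> K \<Longrightarrow> k < 2 ^ m"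
  by (rule less_le_trans[OF le_less_trans[OF _ less_exp[of K]] power_increasing]) (auto simp: m_def)

text \<open>The equations for \<open>\<nu>'\<close> and \<open>es'\<close> keep the arguments of the
  mutual induction variable. The program decrements the fuel inside the search rather than on
  entering it, so \<open>search_fn\<close> receives one unit more than
  \<open>search\<close>.\<close>

lemma runs_best_search:
  "\<nu>' = \<nu> \<Longrightarrow> es' = es \<Longrightarrow> k \<le> K \<Longrightarrow> selection gs \<Longrightarrow>
    runs m P best_fn [Num (int k), elist gs, data B N] (elist (best \<nu>' es' k gs)) (best_time k)"
  "\<nu>' = \<nu> \<Longrightarrow> es' = es \<Longrightarrow> Suc k \<le> K \<Longrightarrow> selection gs \<Longrightarrow> set fs \<subseteq> set es \<Longrightarrow>
    runs m P search_fn [Num (int (Suc k)), elist gs, elist fs, data B N] (elist (search \<nu>' es' k gs fs))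
      ((length fs + 1) * (best_time k + 4 * W))"
proof (induction \<nu>' es' k gs and \<nu>' es' k gs fs rule: best_search.induct)
  case (1 \<nu>' es' gs)
  show ?case by (rule runsI) (simp_all add: program_simps best_body_def)
next
  case (2 \<nu>' es' k gs)
  have IH: "runs m P search_fn [Num (int (Suc k)), elist gs, elist es, data B N] (elist (search \<nu> es k gs es))
      ((length es + 1) * (best_time k + 4 * W))"
    using 2 by blast
  show ?case unfolding 2(2,3)
    by (rule runsI; (simp add: program_simps best_body_def del: of_nat_Suc)?; (rule callI[OF IH])?; simp)
next
  case (3 \<nu>' es' k gs)
  have IH: "runs m P best_fn [Num (int k), elist gs, data B N] (elist (best \<nu> es k gs)) (best_time k)"
    using 3 by simp
  have "Suc k < 2 ^ m" using 3 small_fuel by blast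
  then have "\<bar>1 + int k\<bar> < 2 ^ m"
    by (metis abs_of_nat of_nat_Suc of_nat_less_iff of_nat_numeral of_nat_power)
  then show ?case unfolding 3(2,3) using W_ge(2)
    by (intro runsI; (simp add: program_simps search_body_def)?; (intro callI[OF IH])?; simp)
next
  case (4 \<nu>' es' k gs e fs)
  have e: "e \<in> set es" "set fs \<subseteq> set es" and sel: "selection gs" using 4 by auto
  have gs: "set gs \<subseteq> set es" using sel by (simp add: selection_def)
  note sel' = selection_toggle[OF sel e(1)]
  have IH1: "runs m P best_fn [Num (int k), elist (toggle e gs), data B N] (elist (best \<nu> es k (toggle e gs))) (best_time k)"
    using 4 sel' by simp
  have IH2: "runs m P search_fn [Num (int (Suc k)), elist gs, elist fs, data B N] (elist (search \<nu> es k gs fs))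
      ((length fs + 1) * (best_time k + 4 * W))"
    using 4 by (metis set_subset_Cons subset_trans)
  note tog = runs_toggle[OF e(1) gs]
  note bet = runs_better[OF selection_best(1)[OF refl sel', of \<nu> k] selection_best(2)[OF refl sel e(2), of \<nu> k]]
  have "Suc k < 2 ^ m" using 4 small_fuel by blast
  then have "\<bar>1 + int k\<bar> < 2 ^ m"
    by (metis abs_of_nat of_nat_Suc of_nat_less_iff of_nat_numeral of_nat_power)
  moreover have "20 * (length gs + 1) + 100 \<le> W"
    by (rule toggle_time[OF sel])
  ultimately show ?case unfolding 4(3,4)
    by (intro runsI; (simp add: program_simps search_body_def split del: if_split)?; (intro callI[OF tog])?; simp?;
      (intro callI[OF IH1])?; (simp split del: if_split)?; (intro callI[OF IH2[unfolded of_nat_Suc]])?;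
      (simp split del: if_split)?; (intro callI[OF bet])?; (simp add: Let_def)?)
qed

text \<open>Values are integers bounded by \<open>U\<close>, and every further round raises the
  value by at least 1, so \<open>j\<close> bounds the number of improvements still possible.\<close>

lemma runs_iterate:
  assumes U: "\<And>gs. selection gs \<Longrightarrow> \<nu> gs \<le> U"
  shows "selection gs \<Longrightarrow> nat (U - \<nu> gs) \<le> j \<Longrightarrow>
    \<exists>hs. selection hs \<and> \<nu> gs \<le> \<nu> hs \<and> \<nu> (best \<nu> es K hs) \<le> \<nu> hs \<and>
      runs m P iterate_fn [elist gs, data B N] (elist hs) ((j + 1) * (best_time K + 3 * W))"
proof (induction j arbitrary: gs rule: less_induct)
  case (less j)
  note sel = less.prems(1)
  let ?b = "best \<nu> es K gs"
  have selb: "selection ?b" by (rule selection_best(1)[OF refl sel])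
  note best = runs_best_search(1)[OF refl refl order_refl sel]
  have K: "K < 2 ^ m" by (rule small_fuel) simp
  note small = valuation_small[OF sel] valuation_small[OF selb]
  show ?case
  proof (cases "\<nu> ?b \<le> \<nu> gs")
    case True
    have "runs m P iterate_fn [elist gs, data B N] (elist gs) (best_time K + 3 * W)"
      by (rule runsI; (simp add: program_simps iterate_body_def)?; (rule callI[OF best])?; simp?;
        (rule callI[OF runs_value[OF selb]])?; simp?; (rule callI[OF runs_value[OF sel]])?;
        use True small W_ge in simp)
    then have "runs m P iterate_fn [elist gs, data B N] (elist gs) ((j + 1) * (best_time K + 3 * W))"
      by (rule runs_mono) simp
    then show ?thesis using True sel by blast
  next
    case False
    define j' where "j' = nat (U - \<nu> ?b)"
    have j': "j' < j"
      using False less.prems(2) U[OF selb] U[OF sel] by (simp add: j'_def)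
    from less.IH[OF this selb] obtain hs where hs: "selection hs" "\<nu> ?b \<le> \<nu> hs"
      "\<nu> (best \<nu> es K hs) \<le> \<nu> hs"
      and IH: "runs m P iterate_fn [elist ?b, data B N] (elist hs) ((j' + 1) * (best_time K + 3 * W))"
      by (auto simp: j'_def)
    have "runs m P iterate_fn [elist gs, data B N] (elist hs)
        (best_time K + 3 * W + (j' + 1) * (best_time K + 3 * W))"
      by (rule runsI; (simp add: program_simps iterate_body_def)?; (rule callI[OF best])?; simp?;
        (rule callI[OF runs_value[OF selb]])?; simp?; (rule callI[OF runs_value[OF sel]])?;
        (simp add: False small)?; (rule callI[OF IH])?; use W_ge in simp)
    moreover have "best_time K + 3 * W + (j' + 1) * (best_time K + 3 * W) \<le> (j + 1) * (best_time K + 3 * W)"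
      using mult_le_mono1[of "j' + 2" "j + 1" "best_time K + 3 * W"] j' by simp
    ultimately have "runs m P iterate_fn [elist gs, data B N] (elist hs) ((j + 1) * (best_time K + 3 * W))"
      by (rule runs_mono)
    then show ?thesis using False hs by force
  qed
qed

end

definition price_from :: "(nat, nat) pricing \<Rightarrow> nat list \<Rightarrow> nat \<Rightarrow> rat" where
  "price_from I gs w = (case min_edge I gs w of None \<Rightarrow> 0 | Some e \<Rightarrow> budget I e)"

context encoded_instance
begin

lemma runs_prices:
  assumes gs: "set gs \<subseteq> set es"
  shows "set ws \<subseteq> set V \<Longrightarrow> runs m P prices_fn [vlist ws, elist gs]
    (enc_list (map (\<lambda>w. Pr (enc_nat w) (enc_rat (price_from I gs w))) ws)) (100 * (length gs + 2) * (length ws + 1))"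
proof (induction ws)
  case Nil
  show ?case by (rule runsI) (simp_all add: program_simps prices_body_def)
next
  case (Cons w ws)
  have IH: "runs m P prices_fn [vlist ws, elist gs]
    (enc_list (map (\<lambda>w. Pr (enc_nat w) (enc_rat (price_from I gs w))) ws)) (100 * (length gs + 2) * (length ws + 1))"
    using Cons by simp
  have w: "w < 2 ^ s" using vertex_small Cons.prems by simp
  note me = runs_min_edge[OF w gs]
  show ?case
    by (rule runsI; (simp add: program_simps prices_body_def)?; (rule callI[OF me])?;
      cases "min_edge I gs w"; simp?; (rule callI[OF IH])?;
      simp add: price_from_def enc_nat_def enc_rat_def rat_zero_code case_prod_beta)
qed

lemma runs_names:
  "runs m P names_fn [elist gs] (enc_list (map enc_nat gs)) (20 * (length gs + 1))"
proof (induction gs)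
  case Nil
  show ?case by (rule runsI) (simp_all add: program_simps names_body_def)
next
  case (Cons g gs)
  show ?case by (rule runsI) (auto simp: program_simps names_body_def enc_nat_def intro!: callI[OF Cons.IH])
qed

lemma runs_length:
  "length xs < 2 ^ s \<Longrightarrow> runs m P length_fn [enc_list xs] (Num (int (length xs))) (20 * (length xs + 1))"
proof (induction xs)
  case Nil
  show ?case by (rule runsI) (simp_all add: program_simps length_body_def)
next
  case (Cons x xs)
  have IH: "runs m P length_fn [enc_list xs] (Num (int (length xs))) (20 * (length xs + 1))"
    using Cons by simp
  have "length xs < 2 ^ s" using Cons by simp
  then show ?case by (intro runsI) (auto simp: program_simps length_body_def intro!: callI[OF IH])
qed

end

subsection \<open>Correctness and polynomial running time\<close>

lemma degree_in_eq_card: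
  "distinct gs \<Longrightarrow> degree_in I gs w = card {e\<in>set gs. left_end I e = w \<or> right_end I e = w}"
  unfolding degree_in_def by (subst distinct_length_filter) (auto intro: arg_cong[where f = card])

lemma min_edge_eq_None: "min_edge I gs w = None \<longleftrightarrow> at_left I (set gs) w = {}"
  by (induction gs) (auto simp: at_left_def split: option.splits if_splits)

lemma min_edge_le: "min_edge I gs w = Some e \<Longrightarrow> f \<in> at_left I (set gs) w \<Longrightarrow> budget I e \<le> budget I f"
proof (induction gs arbitrary: e f)
  case (Cons g gs)
  show ?case
  proof (cases "min_edge I gs w")
    case None
    then have "at_left I (set gs) w = {}"
      by (simp add: min_edge_eq_None)
    then show ?thesis using Cons.prems None by (auto simp: at_left_def split: if_splits)
  next
    case (Some h)
    note IH = Cons.IH[OF Some]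
    have "f = g \<and> left_end I g = w \<or> f \<in> at_left I (set gs) w"
      using Cons.prems(2) by (auto simp: at_left_def)
    then show ?thesis
      using Cons.prems(1) Some IH by (fastforce split: if_splits)
  qed
qed (simp add: at_left_def)

lemma min_edge_at_left:
  assumes "min_edge I gs w = Some e"
  shows "e \<in> at_left I (set gs) w"
  using assms by (induction gs arbitrary: e) (auto simp: at_left_def split: if_splits option.splits)

text \<open>A monotone map commutes with the minimum; this serves both the exact budgets and the
  scaled ones.\<close>

lemma Min_at_left:
  assumes e: "min_edge I gs w = Some e" and mono: "\<And>x y. x \<le> y \<Longrightarrow> f x \<le> (f y :: real)"
  shows "Min ((\<lambda>e. f (budget I e)) ` at_left I (set gs) w) = f (budget I e)"
  using min_edge_at_left[OF e] min_edge_le[OF e] mono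
  by (intro Min_eqI) (auto simp: at_left_def)

lemma max_budget_ge: "e \<in> set fs \<Longrightarrow> fits I ws [e] \<Longrightarrow> budget I e \<le> max_budget I ws fs"
  by (induction fs) (auto simp: Let_def intro: order_trans)

lemma max_budget_nonneg: "0 \<le> max_budget I ws fs"
  by (induction fs) (auto simp: Let_def)

lemma max_budget_attained:
  "max_budget I ws fs = 0 \<or> (\<exists>e\<in>set fs. fits I ws [e] \<and> budget I e = max_budget I ws fs)"
  by (induction fs) (auto simp: Let_def)

lemma scale_eq_floor: "scale B N r = \<lfloor>of_rat r * of_int N / (of_rat B :: real)\<rfloor>"
proof -
  obtain n d where r: "quotient_of r = (n, d)" by (cases "quotient_of r")
  obtain a b where B: "quotient_of B = (a, b)" by (cases "quotient_of B")
  have "of_rat r = (of_int n / of_int d :: real)" "of_rat B = (of_int a / of_int b :: real)"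
    using quotient_of_div[OF r] quotient_of_div[OF B] by (simp_all add: of_rat_divide)
  then have "of_rat r * of_int N / (of_rat B :: real) = of_int (n * N * b) / of_int (d * a)"
    by simp
  then show ?thesis
    using floor_divide_of_int_eq[of "n * N * b" "d * a", where ?'a = real] by (simp add: scale_def r B)
qed

lemma scale_mono:
  assumes "0 \<le> N" "0 \<le> B" "x \<le> y"
  shows "scale B N x \<le> scale B N y"
  unfolding scale_eq_floor using assms
  by (intro floor_mono divide_right_mono mult_right_mono) (auto simp: of_rat_less_eq)

lemma of_rat_mono_real: "x \<le> y \<Longrightarrow> (of_rat x :: real) \<le> of_rat y"
  by (simp add: of_rat_less_eq)

section \<open>Rounded values of an input instance\<close>

locale solver = capacitated I C + encoded_instance I "us @ vs" es s K c
  for I :: "(nat, nat) pricing" and C us vs es s K c +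
  assumes us: "distinct us" "set us = lefts I" and vs: "distinct vs" "set vs = rights I"
    and es: "distinct es" "set es = edges I"
begin

abbreviation "V \<equiv> us @ vs"
abbreviation "B \<equiv> max_budget I V es"
abbreviation "N \<equiv> int c * int (length es)"

sublocale encoded_data I V es s K c B N
proof
  show "small_rat B" by (rule small_rat_max_budget) simp
  show "0 \<le> B" by (rule max_budget_nonneg)
  show "0 \<le> N" by simp
  have "int c < 2 ^ c"
    by (metis less_exp of_nat_less_iff of_nat_numeral of_nat_power)
  moreover have "int (length es) < 2 ^ s"
    using length_small(2) by (metis of_nat_less_iff of_nat_numeral of_nat_power)
  ultimately show "N < 2 ^ (s + c)"
    using abs_mult_less_power[of "int c" c "int (length es)" s] by (simp add: add.commute)
qed

definition scaled :: "nat \<Rightarrow> real" where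
  "scaled e = of_int (scale B N (budget I e))"

lemma fits_iff: "selection gs \<Longrightarrow> fits I V gs \<longleftrightarrow> within_capacity I (set gs)"
  using us vs es by (auto simp: selection_def fits_def within_capacity_def degree_in_eq_card)

lemma valuation_eq:
  assumes gs: "selection gs"
  shows "real_of_int (\<nu> gs) = (if within_capacity I (set gs) then gain I scaled (set gs) else - 1)"
proof -
  have sub: "set gs \<subseteq> edges I" and dist: "distinct gs" using gs es by (auto simp: selection_def)
  \<comment> \<open>The program sums over all vertices, but no edge has its left end in
    \<open>rights I\<close>.\<close>
  have right: "scaled_revenue I B N gs w = 0" if "w \<in> set vs" for w
  proof -
    have "at_left I (set gs) w = {}"
      using that vs sub left_end disjoint by (auto simp: at_left_def)
    then show ?thesis by (simp add: scaled_revenue_def min_edge_eq_None[symmetric])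
  qed
  have left: "real_of_int (scaled_revenue I B N gs w) =
      real (card (at_left I (set gs) w)) * Min (scaled ` at_left I (set gs) w)" if "w \<in> lefts I" for w
  proof (cases "min_edge I gs w")
    case None
    then have "at_left I (set gs) w = {}" by (simp only: min_edge_eq_None)
    with None show ?thesis by (simp add: scaled_revenue_def)
  next
    case (Some e)
    have "Min (scaled ` at_left I (set gs) w) = scaled e"
      using Min_at_left[OF Some, of "\<lambda>r. of_int (scale B N r)"] scale_mono[OF _ max_budget_nonneg]
      by (simp add: scaled_def)
    moreover have "degree_in I gs w = card (at_left I (set gs) w)"
      using degree_in_eq_card[OF dist] incident_left[OF sub that] by simp
    ultimately show ?thesis using Some by (simp add: scaled_revenue_def scaled_def)
  qed
  have "(\<Sum>w\<leftarrow>V. scaled_revenue I B N gs w) = (\<Sum>w\<leftarrow>us. scaled_revenue I B N gs w)"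
    using right by (simp add: sum_list_0[symmetric] cong: map_cong)
  also have "\<dots> = (\<Sum>w\<in>lefts I. scaled_revenue I B N gs w)"
    using us by (simp add: sum_list_distinct_conv_sum_set)
  finally show ?thesis
    using left fits_iff[OF gs] by (simp add: valuation_def gain_def)
qed

definition set_value :: "nat set \<Rightarrow> real" where
  "set_value H = (if within_capacity I H then gain I scaled H else - 1)"

text \<open>Toggling an edge in which the current set differs from \<open>H\<close> lowers the
  distance by 1. The second claim carries the invariant of the scan: the remaining fuel suffices
  without a toggle, or a suitable edge is still ahead.\<close>

lemma best_optimal:
  "f = \<nu> \<Longrightarrow> fs' = es \<Longrightarrow> selection gs \<Longrightarrow> H \<subseteq> set es \<Longrightarrow>
     card ((set gs - H) \<union> (H - set gs)) \<le> k \<Longrightarrow> set_value H \<le> \<nu> (best f fs' k gs)"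
  "f = \<nu> \<Longrightarrow> fs' = es \<Longrightarrow> selection gs \<Longrightarrow> set fs \<subseteq> set es \<Longrightarrow> H \<subseteq> set es \<Longrightarrow>
     card ((set gs - H) \<union> (H - set gs)) \<le> k \<or>
     (\<exists>e\<in>set fs. card ((set (toggle e gs) - H) \<union> (H - set (toggle e gs))) \<le> k) \<Longrightarrow>
     set_value H \<le> \<nu> (search f fs' k gs fs)"
proof (induction f fs' k gs and f fs' k gs fs rule: best_search.induct)
  case (1 f fs' gs)
  have "finite ((set gs - H) \<union> (H - set gs))"
    using 1 by (auto intro: finite_subset)
  then have "H = set gs" using 1 by auto
  then show ?case using 1 valuation_eq by (simp add: set_value_def)
next
  case (2 f fs' k gs)
  let ?D = "(set gs - H) \<union> (H - set gs)"
  have fin: "finite ?D"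
    using 2 by (auto intro: finite_subset)
  \<comment> \<open>If the sets already agree, the unit of fuel is spent at the end of the edge
    list.\<close>
  have "card ?D \<le> k \<or> (\<exists>e\<in>set es. card ((set (toggle e gs) - H) \<union> (H - set (toggle e gs))) \<le> k)"
  proof (cases "?D = {}")
    case False
    then obtain e where e: "e \<in> ?D" by blast
    then have "e \<in> set es" using 2 by (auto simp: selection_def)
    moreover have "(set (toggle e gs) - H) \<union> (H - set (toggle e gs)) = ?D - {e}"
      using toggle_distinct[of gs e] e 2(4) by (auto simp: selection_def)
    moreover have "card (?D - {e}) \<le> k"
      using 2(6) fin e by simp
    ultimately show ?thesis by metis
  next
    case True
    then have "card ?D = 0" by (simp only: card.empty)
    then show ?thesis by linarith
  qed
  then show ?case using 2 by simp
next
  case (3 f fs' k gs)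
  then show ?case by simp
next
  case (4 f fs' k gs e fs)
  have sel: "selection (toggle e gs)" using 4 selection_toggle by simp
  have "set_value H \<le> \<nu> (best \<nu> es k (toggle e gs)) \<or> set_value H \<le> \<nu> (search \<nu> es k gs fs)"
    using 4 sel by auto
  then show ?case using 4(3,4) by (auto simp: Let_def)
qed

lemma local_optimum:
  assumes gs: "selection gs" and best: "\<nu> (best \<nu> es K gs) \<le> \<nu> gs" and F: "within_capacity I (set gs)"
    and H: "within_capacity I H" "card ((set gs - H) \<union> (H - set gs)) \<le> K"
  shows "gain I scaled H \<le> gain I scaled (set gs)"
proof -
  have "H \<subseteq> set es" using H es by (simp add: within_capacity_def)
  then have "set_value H \<le> \<nu> (best \<nu> es K gs)"
    using best_optimal(1)[OF refl refl gs] H by blast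
  also have "\<dots> \<le> \<nu> gs" using best by simp
  finally show ?thesis
    using H F valuation_eq[OF gs] by (simp add: set_value_def)
qed

lemma within_capacity_mono:
  assumes "within_capacity I F" "G \<subseteq> F"
  shows "within_capacity I G"
proof -
  have "F \<subseteq> edges I" using assms by (simp add: within_capacity_def)
  then have fin: "finite F" by (rule finite_edges)
  have "enat (card {e\<in>G. left_end I e = w \<or> right_end I e = w}) \<le> capacity I w"
    if "w \<in> lefts I \<union> rights I" for w
  proof -
    have "card {e\<in>G. left_end I e = w \<or> right_end I e = w} \<le> card {e\<in>F. left_end I e = w \<or> right_end I e = w}"
      using assms(2) fin by (intro card_mono) auto
    moreover have "enat (card {e\<in>F. left_end I e = w \<or> right_end I e = w}) \<le> capacity I w"
      using assms(1) that by (simp add: within_capacity_def)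
    ultimately show ?thesis
      by (meson enat_ord_simps(1) order_trans)
  qed
  then show ?thesis using assms by (auto simp: within_capacity_def)
qed

lemma fits_singleton:
  assumes "within_capacity I F" "e \<in> F"
  shows "e \<in> set es" "fits I V [e]"
proof -
  show e: "e \<in> set es" using assms es by (auto simp: within_capacity_def)
  have "within_capacity I (set [e])"
    using within_capacity_mono[OF assms(1), of "{e}"] assms(2) by simp
  then show "fits I V [e]"
    using fits_iff[of "[e]"] e by (simp add: selection_def)
qed

text \<open>An edge of a set within the capacities can be sold alone, so its budget is at most
  \<open>B\<close> and scales to at most \<open>N\<close>. The number of improvements is thus at
  most \<open>c * length es * length es\<close>, whatever the budgets are.\<close>

lemma valuation_le:
  assumes gs: "selection gs"
  shows "\<nu> gs \<le> N * int (length es)"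
proof (cases "within_capacity I (set gs)")
  case True
  have "scaled e \<le> N" if e: "e \<in> set gs" for e
  proof -
    have "budget I e \<le> B"
      using fits_singleton[OF True e] max_budget_ge by blast
    then have "scale B N (budget I e) \<le> scale B N B"
      by (intro scale_mono max_budget_nonneg) simp
    also have "\<dots> \<le> N"
    proof (cases "B = 0")
      case False
      then have "of_rat B * of_int N / of_rat B = real_of_int N" by simp
      then show ?thesis by (simp only: scale_eq_floor floor_of_int)
    qed (simp add: scale_eq_floor)
    finally show ?thesis unfolding scaled_def by (simp only: of_int_le_iff)
  qed
  then have "gain I scaled (set gs) \<le> N * real (card (set gs))"
    using gain_mono_affine[of "set gs" scaled 0 scaled "of_int N"] True by (auto simp: within_capacity_def)
  also have "\<dots> \<le> real_of_int N * real (length es)"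
    using selection_length[OF gs] gs by (intro mult_left_mono) (auto simp: distinct_card selection_def)
  finally have "real_of_int (\<nu> gs) \<le> real_of_int (N * int (length es))"
    using valuation_eq[OF gs] True by simp
  then show ?thesis by linarith
next
  case False
  then have "real_of_int (\<nu> gs) = - 1" using valuation_eq[OF gs] by simp
  then have "\<nu> gs = - 1" by linarith
  moreover have "0 \<le> N * int (length es)" by simp
  ultimately show ?thesis by linarith
qed

text \<open>Selling only the edge that attains \<open>B\<close> earns \<open>B\<close>, so the
  optimum absorbs the rounding error. If \<open>B = 0\<close>, no sellable edge has a positive
  budget and the optimum is 0.\<close>

lemma opt_le_of_local_optimum:
  assumes F: "within_capacity I F"
    and local: "\<And>H. within_capacity I H \<Longrightarrow>
      card ((F - H) \<union> (H - F)) \<le> 3 * (Suc \<rho> * Suc C ^ \<rho> * C) \<Longrightarrow> gain I scaled H \<le> gain I scaled F"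
    and C: "1 \<le> C" and c: "1 \<le> c"
  shows "opt_revenue I \<le> (2 - 1 / real C + 1 / (real C * real (Suc \<rho>))) * gain I (real_budget I) F
    + opt_revenue I / real c"
proof (cases "B = 0")
  case True
  have opt0: "0 \<le> opt_revenue I"
    using revenue_le_opt_revenue[OF inst feasible_empty[OF inst]] by (simp add: revenue_def)
  have "gain I (real_budget I) G \<le> 0" if G: "within_capacity I G" for G
  proof -
    have "real_budget I e \<le> 0" if "e \<in> G" for e
      using max_budget_ge[OF fits_singleton[OF G that]] True by (simp add: of_rat_le_0_iff)
    then show ?thesis
      using gain_mono_affine[of G "real_budget I" 0 "real_budget I" 0] G by (auto simp: within_capacity_def)
  qed
  then have "opt_revenue I \<le> 0" by (rule opt_revenue_le)
  moreover have "0 \<le> gain I (real_budget I) F"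
    using F inst by (intro gain_nonneg) (auto simp: within_capacity_def pricing_instance_def)
  moreover have "1 / real C \<le> 1" "0 \<le> 1 / (real C * real (Suc \<rho>))"
    using C by simp_all
  then have "0 \<le> 2 - 1 / real C + 1 / (real C * real (Suc \<rho>))" by linarith
  ultimately show ?thesis using opt0 by simp
next
  case False
  then have Bpos: "0 < (of_rat B :: real)"
    using max_budget_nonneg[of I V es] by simp
  from False obtain e where e: "e \<in> set es" "fits I V [e]" "budget I e = B"
    using max_budget_attained[of I V es] by blast
  then have n: "0 < length es" by auto
  define t where "t = real_of_int N / of_rat B"
  have t: "0 < t" using Bpos n c by (simp add: t_def)
  have e1: "within_capacity I {e}"
    using fits_iff[of "[e]"] e by (simp add: selection_def)
  define p where "p u = (if u = left_end I e then real_budget I e else 0)" for u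
  have "feasible I p {e}" "revenue I p {e} = gain I (real_budget I) {e}"
    using e es left_end disjoint right_end
    by (intro feasible_min_price[OF e1]; force simp: p_def at_left_def)+
  moreover have "revenue I p {e} = real_budget I e"
    using e es left_end[of e] right_end[of e] disjoint by (auto simp: revenue_def p_def)
  ultimately have opt: "of_rat B \<le> opt_revenue I"
    using revenue_le_opt_revenue[OF inst, of p "{e}"] e by simp
  \<comment> \<open>The number of edges cancels against the factor \<open>length es\<close> in
    \<open>N\<close>.\<close>
  have "real (card (edges I)) / t = of_rat B / real c"
    using es n by (simp add: t_def distinct_card[symmetric])
  also have "\<dots> \<le> opt_revenue I / real c"
    using opt by (intro divide_right_mono) auto
  finally have le: "real (card (edges I)) / t \<le> opt_revenue I / real c" .
  have "0 \<le> scaled e \<and> scaled e \<le> t * real_budget I e \<and> t * real_budget I e \<le> scaled e + 1"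
    if "e \<in> edges I" for e
  proof -
    have "0 \<le> real_budget I e" using inst that by (simp add: pricing_instance_def)
    then have "0 \<le> t * real_budget I e" using t by simp
    moreover have "scaled e = of_int \<lfloor>t * real_budget I e\<rfloor>"
      by (simp add: scaled_def scale_eq_floor t_def mult.commute)
    ultimately show ?thesis by simp
  qed
  from rounded_local_optimum_ratio[OF F _ local C t this] le
  show ?thesis by (intro opt_revenue_le) force
qed

end

context solver
begin

lemma valuation_Nil: "\<nu> [] = 0"
proof -
  have "fits I V []"
    by (auto simp: fits_def degree_in_def zero_enat_def[symmetric])
  moreover have "scaled_revenue I B N [] = (\<lambda>_. 0)"
    by (rule ext) (simp add: scaled_revenue_def)
  ultimately show ?thesis by (simp add: valuation_def)
qed

lemma runs_main:
  obtains hs where "selection hs" "within_capacity I (set hs)" "\<nu> (best \<nu> es K hs) \<le> \<nu> hs"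
    "runs m P main_fn [Pr (vlist us) (Pr (vlist vs) (elist es))]
      (Pr (enc_list (map (\<lambda>w. Pr (enc_nat w) (enc_rat (price_from I hs w))) V)) (enc_list (map enc_nat hs)))
      ((c * length es * length es + 1) * (best_time K + 3 * W) + W)"
proof -
  define U where "U = c * length es * length es"
  have "selection []" by (simp add: selection_def)
  moreover have "nat (N * int (length es) - \<nu> []) \<le> U"
    by (simp add: valuation_Nil U_def nat_mult_distrib)
  ultimately obtain hs where hs: "selection hs" "\<nu> [] \<le> \<nu> hs" "\<nu> (best \<nu> es K hs) \<le> \<nu> hs"
    and iter: "runs m P iterate_fn [elist [], data B N] (elist hs) ((U + 1) * (best_time K + 3 * W))"
    using runs_iterate[OF valuation_le] by blast
  \<comment> \<open>The search starts at the empty set with value 0 and never loses value, which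
    excludes the value - 1.\<close>
  have "within_capacity I (set hs)"
  proof (rule ccontr)
    assume "\<not> within_capacity I (set hs)"
    then have "real_of_int (\<nu> hs) = - 1" using valuation_eq[OF hs(1)] by simp
    then show False using hs(2) valuation_Nil by linarith
  qed
  define w where "w = (length es + 1) * (length V + 1)"
  have w: "W = 1000 * w" "length V + 1 \<le> w" "length es + 1 \<le> w"
    unfolding W_def w_def by (simp_all only: mult.assoc) simp_all
  have len: "length hs \<le> length es" by (rule selection_length[OF hs(1)])
  have sub: "set hs \<subseteq> set es" using hs(1) by (simp add: selection_def)
  have app: "runs m P append_fn [vlist us, vlist vs] (vlist V) (20 * w)"
    using runs_mono[OF runs_append[of "map (enc_vertex I) us" "map (enc_vertex I) vs"], of "20 * w"] w(2) by simp
  have "300 * (length V + 1) * (length es + 1) \<le> 300 * w"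
    by (simp only: w_def mult.assoc mult.commute[of "length V + 1"])
  from runs_mono[OF runs_max_budget[OF subset_refl] this]
  have maxb: "runs m P max_budget_fn [vlist V, elist es] (enc_rat B) (300 * w)" .
  have len_es: "runs m P length_fn [elist es] (Num (int (length es))) (20 * w)"
    using runs_mono[OF runs_length[of "map (enc_edge I) es"], of "20 * w"] length_small(2) w(3) by simp
  have "100 * (length hs + 2) \<le> 200 * (length es + 1)" using len by simp
  from mult_le_mono1[OF this] have "100 * (length hs + 2) * (length V + 1) \<le> 200 * w"
    by (simp only: w_def mult.assoc)
  from runs_mono[OF runs_prices[OF sub subset_refl] this]
  have prices: "runs m P prices_fn [vlist V, elist hs]
      (enc_list (map (\<lambda>w. Pr (enc_nat w) (enc_rat (price_from I hs w))) V)) (200 * w)" .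
  have names: "runs m P names_fn [elist hs] (enc_list (map enc_nat hs)) (20 * w)"
    using runs_mono[OF runs_names[of hs], of "20 * w"] len w(3) by simp
  have "int c < 2 ^ m"
  proof -
    have "c < 2 ^ m"
      by (rule less_le_trans[OF less_exp[of c] power_increasing]) (auto simp: m_def)
    then show ?thesis by (metis of_nat_less_iff of_nat_numeral of_nat_power)
  qed
  moreover have "int (length es) < 2 ^ m"
    using small_nat[OF length_small(2)] by (metis of_nat_less_iff of_nat_numeral of_nat_power)
  ultimately have "runs m P main_fn [Pr (vlist us) (Pr (vlist vs) (elist es))]
      (Pr (enc_list (map (\<lambda>w. Pr (enc_nat w) (enc_rat (price_from I hs w))) V)) (enc_list (map enc_nat hs)))
      ((U + 1) * (best_time K + 3 * W) + W)"
    by (intro runsI; (simp add: program_simps main_body_def del: map_append enc_list.simps)?; (intro callI[OF app])?;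
      (simp del: map_append)?; (intro callI[OF maxb])?; (simp del: map_append)?; (intro callI[OF len_es])?;
      (simp del: map_append)?; (intro callI[OF iter[unfolded list.map enc_list.simps]])?; (simp del: map_append)?;
      (intro callI[OF prices])?; (simp del: map_append)?; (intro callI[OF names])?;
      use w in \<open>simp del: map_append\<close>)
  then show ?thesis
    using that hs \<open>within_capacity I (set hs)\<close> by (simp only: U_def)
qed

end

section \<open>Size of the encoding and the final bounds\<close>

lemma abs_less_power_bit_size:
  assumes "bit_size i \<le> s"
  shows "\<bar>i\<bar> < 2 ^ s"
proof -
  have "floorlog 2 (nat \<bar>i\<bar>) \<le> s"
    using assms by (simp add: bit_size_def)
  then have "nat \<bar>i\<bar> < 2 ^ s"
    by (rule floorlog_leD) simp
  then show ?thesis by (simp add: nat_less_iff)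
qed

lemma nat_less_power_val_size: "val_size (enc_nat n) \<le> s \<Longrightarrow> n < 2 ^ s"
  using abs_less_power_bit_size[of "int n" s]
  by (simp add: enc_nat_def)

lemma length_less_val_size: "length xs < val_size (enc_list xs)"
proof (induction xs)
  case (Cons x xs)
  then show ?case by simp
qed (simp add: bit_size_def)

lemma val_size_element: "x \<in> set xs \<Longrightarrow> val_size x \<le> val_size (enc_list xs)"
  by (induction xs) auto

text \<open>All numbers of the instance are leaves of \<open>x\<close>, so the size of
  \<open>x\<close> bounds their bit lengths as well as the lengths of the lists and can serve as
  \<open>s\<close>.\<close>

lemma solverI:
  assumes I: "pricing_instance I" "\<forall>v\<in>lefts I. capacity I v \<le> enat C"
    and us: "distinct us" "set us = lefts I" and vs: "distinct vs" "set vs = rights I"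
    and es: "distinct es" "set es = edges I"
    and x: "x = Pr (enc_list (map (enc_vertex I) us))
              (Pr (enc_list (map (enc_vertex I) vs)) (enc_list (map (enc_edge I) es)))"
  shows "solver I C us vs es (val_size x)"
proof -
  let ?s = "val_size x"
  have vertex: "val_size (enc_vertex I w) \<le> ?s" if "w \<in> set (us @ vs)" for w
    using that val_size_element[of "enc_vertex I w" "map (enc_vertex I) us"]
      val_size_element[of "enc_vertex I w" "map (enc_vertex I) vs"] by (auto simp: x)
  have edge: "val_size (enc_edge I e) \<le> ?s" if "e \<in> set es" for e
    using that val_size_element[of "enc_edge I e" "map (enc_edge I) es"] by (auto simp: x)
  have edge_parts: "val_size (enc_nat e) \<le> ?s" "val_size (enc_nat (left_end I e)) \<le> ?s"
    "val_size (enc_nat (right_end I e)) \<le> ?s"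
    "bit_size (fst (quotient_of (budget I e))) \<le> ?s" "bit_size (snd (quotient_of (budget I e))) \<le> ?s"
    if "e \<in> set es" for e
    using edge[OF that] by (simp_all add: enc_edge_def enc_rat_def case_prod_beta)
  have len: "length (us @ vs) < ?s" "length es < ?s"
    using length_less_val_size[of "map (enc_vertex I) us"] length_less_val_size[of "map (enc_vertex I) vs"]
      length_less_val_size[of "map (enc_edge I) es"] by (simp_all add: x)
  show ?thesis
  proof
    show "pricing_instance I" "\<forall>v\<in>lefts I. capacity I v \<le> enat C" by fact+
    show "w < 2 ^ ?s" if "w \<in> set (us @ vs)" for w
      using vertex[OF that] by (intro nat_less_power_val_size) (simp add: enc_vertex_def)
    show "n < 2 ^ ?s" if "w \<in> set (us @ vs)" "capacity I w = enat n" for w n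
      using vertex[OF that(1)] that(2)
      by (intro nat_less_power_val_size) (simp add: enc_vertex_def enc_capacity_def)
    show "0 \<le> budget I e" if "e \<in> set es" for e
      using I that es by (simp add: pricing_instance_def)
    show "e < 2 ^ ?s" "left_end I e < 2 ^ ?s" "right_end I e < 2 ^ ?s"
      "\<bar>fst (quotient_of (budget I e))\<bar> < 2 ^ ?s" "snd (quotient_of (budget I e)) < 2 ^ ?s" if "e \<in> set es" for e
      using edge_parts[OF that] abs_less_power_bit_size[of "snd (quotient_of (budget I e))" ?s]
      by (auto intro: nat_less_power_val_size abs_less_power_bit_size)
    show "1 \<le> ?s" using len by simp
    show "length (us @ vs) < 2 ^ ?s" "length es < 2 ^ ?s"
      using len less_exp[of ?s] by linarith+
  qed (fact us vs es)+
qed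

primrec best_time_poly :: "nat \<Rightarrow> nat poly" where
  "best_time_poly 0 = [:10:]"
| "best_time_poly (Suc k) = [:1, 1:] * (best_time_poly k + [:4000:] * ([:1, 1:] * [:1, 1:])) + [:20:]"

text \<open>The factor \<open>[:1, 0, c:]\<close> counts the rounds, the last factor is the cost
  unit \<open>2 * m + 3\<close> as a polynomial in \<open>s\<close>, and the leading 2 pays for the
  initial call.\<close>

definition time_poly :: "nat \<Rightarrow> nat \<Rightarrow> nat poly" where
  "time_poly K c = [:2:] + (([:1, 0, c:] * (best_time_poly K + [:3000:] * ([:1, 1:] * [:1, 1:])) +
     [:1000:] * ([:1, 1:] * [:1, 1:])) * [:2 * (c + K + 5) + 3, 10:])"

context solver
begin

lemma time_le:
  assumes "length V \<le> s" "length es \<le> s"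
  shows "2 + ((c * length es * length es + 1) * (best_time K + 3 * W) + W) * (2 * m + 3) \<le> poly (time_poly K c) s"
proof -
  define w where "w = (1 + s) * (1 + s)"
  have W: "W \<le> 1000 * w"
    unfolding W_def w_def mult.assoc using assms by (intro mult_le_mono) auto
  have best: "best_time k \<le> poly (best_time_poly k) s" for k
  proof (induction k)
    case (Suc k)
    have "(length es + 1) * (best_time k + 4 * W) \<le> (1 + s) * (poly (best_time_poly k) s + 4000 * w)"
      using assms Suc W by (intro mult_le_mono) auto
    then show ?case by (simp add: w_def algebra_simps)
  qed simp
  have "c * length es * length es + 1 \<le> 1 + s * (s * c)"
    using mult_le_mono[OF mult_le_mono[OF order_refl[of c] assms(2)] assms(2)] by (simp add: mult_ac)
  moreover have "best_time K + 3 * W \<le> poly (best_time_poly K) s + 3000 * w"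
    using best[of K] W by simp
  ultimately have "(c * length es * length es + 1) * (best_time K + 3 * W) \<le>
      (1 + s * (s * c)) * (poly (best_time_poly K) s + 3000 * w)"
    by (rule mult_le_mono)
  then have "(c * length es * length es + 1) * (best_time K + 3 * W) + W \<le>
      (1 + s * (s * c)) * (poly (best_time_poly K) s + 3000 * w) + 1000 * w"
    using W by (rule add_mono)
  from mult_le_mono1[OF this, of "2 * m + 3"] show ?thesis
    by (simp add: time_poly_def w_def m_def algebra_simps)
qed

lemma price_properties:
  assumes gs: "within_capacity I (set gs)"
  defines "p \<equiv> \<lambda>w. real_of_rat (price_from I gs w)"
  shows "feasible I p (set gs)" "revenue I p (set gs) = gain I (real_budget I) (set gs)"
proof -
  have empty: "p w = 0" if "at_left I (set gs) w = {}" for w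
    using that by (simp add: p_def price_from_def min_edge_eq_None[symmetric])
  have left: "p w = Min (real_budget I ` at_left I (set gs) w)" if "at_left I (set gs) w \<noteq> {}" for w
  proof -
    from that obtain e where e: "min_edge I gs w = Some e"
      unfolding min_edge_eq_None[symmetric] by blast
    then show ?thesis
      using Min_at_left[OF e, of of_rat] of_rat_mono_real by (simp add: p_def price_from_def)
  qed
  have right: "p w = 0" if "w \<in> rights I" for w
    using that gs left_end disjoint by (intro empty) (auto simp: at_left_def within_capacity_def)
  show "feasible I p (set gs)" "revenue I p (set gs) = gain I (real_budget I) (set gs)"
    by (rule feasible_min_price[OF gs]; simp add: empty left right)+
qed

end

theorem theorem4:
  fixes C :: nat and \<epsilon> :: real
  assumes "C \<ge> 2" and "\<epsilon> > 0"
  shows "\<exists>P. polytime_approximation P ((2 * real C - 1) / real C + \<epsilon>)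
           {I. pricing_instance I \<and> (\<forall>v\<in>lefts I. capacity I v \<le> enat C)}"
proof -
  define \<alpha> where "\<alpha> = (2 * real C - 1) / real C + \<epsilon>"
  have C: "1 \<le> C" "1 / real C \<le> 1" using assms by auto
  have \<alpha>: "\<alpha> = 2 - 1 / real C + \<epsilon>"
    using C by (simp add: \<alpha>_def field_simps)
  have \<alpha>1: "1 \<le> \<alpha> - \<epsilon> / 2" "0 < \<alpha>"
    using C assms(2) unfolding \<alpha> by linarith+
  then have pos: "0 < \<alpha> - \<epsilon> / 2" by linarith
  \<comment> \<open>Half of \<epsilon> covers the excess term of the local search ratio; the other
    half is left to rounding, which may lose a fraction \<open>\<epsilon> / 2 / \<alpha>\<close> of
    the optimum.\<close>
  obtain \<rho> where \<rho>: "inverse (real (Suc \<rho>)) < \<epsilon> / 2"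
    using reals_Archimedean[of "\<epsilon> / 2"] assms(2) by auto
  obtain c' where c': "inverse (real (Suc c')) < \<epsilon> / 2 / \<alpha>"
    using reals_Archimedean[of "\<epsilon> / 2 / \<alpha>"] assms(2) \<alpha>1 by auto
  define c where "c = Suc c'"
  define K where "K = 3 * (Suc \<rho> * Suc C ^ \<rho> * C)"
  have "1 / (real C * real (Suc \<rho>)) \<le> 1 / real (Suc \<rho>)"
    using C by (intro divide_left_mono) auto
  then have a: "2 - 1 / real C + 1 / (real C * real (Suc \<rho>)) \<le> \<alpha> - \<epsilon> / 2"
    using \<rho> unfolding \<alpha> by (simp add: inverse_eq_divide)
  have "\<exists>y t p F. computes_in (pricing_program K c) x y t \<and> t \<le> poly (time_poly K c) (val_size x) \<and>
      encodes_solution y I p F \<and> feasible I p F \<and> revenue I p F \<ge> inverse \<alpha> * opt_revenue I"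
    if I: "pricing_instance I" "\<forall>v\<in>lefts I. capacity I v \<le> enat C" and x: "encodes_instance x I" for I x
  proof -
    from x obtain us vs es where us: "distinct us" "set us = lefts I" and vs: "distinct vs" "set vs = rights I"
      and es: "distinct es" "set es = edges I"
      and x: "x = Pr (enc_list (map (enc_vertex I) us))
              (Pr (enc_list (map (enc_vertex I) vs)) (enc_list (map (enc_edge I) es)))"
      by (auto simp: encodes_instance_def)
    interpret solver I C us vs es "val_size x" K c
      by (rule solverI[OF I us vs es x])
    obtain hs where hs: "selection hs" and F: "within_capacity I (set hs)"
      and opt: "\<nu> (best \<nu> es K hs) \<le> \<nu> hs"
      and run: "runs m P main_fn [Pr (vlist us) (Pr (vlist vs) (elist es))]
      (Pr (enc_list (map (\<lambda>w. Pr (enc_nat w) (enc_rat (price_from I hs w))) V)) (enc_list (map enc_nat hs)))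
      ((c * length es * length es + 1) * (best_time K + 3 * W) + W)"
      by (rule runs_main)
    let ?y = "Pr (enc_list (map (\<lambda>w. Pr (enc_nat w) (enc_rat (price_from I hs w))) V)) (enc_list (map enc_nat hs))"
    let ?p = "\<lambda>w. real_of_rat (price_from I hs w)"
    let ?T = "(c * length es * length es + 1) * (best_time K + 3 * W) + W"
    from run obtain t where t: "eval P [x] (P ! main_fn) ?y t" "t \<le> ?T * (2 * m + 3)" and "main_fn < length P"
      unfolding x by (auto simp: runs_def evaluates_def)
    have "eval P [x] (Var 0) ([x] ! 0) 1"
      by (rule eval_Var) simp
    then have "eval_list P [x] [Var 0] [x] 1"
      using eval_list_Cons[OF _ eval_list_Nil] by fastforce
    from eval_Call[OF \<open>main_fn < length P\<close> this t(1)]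
    have comp: "computes_in P x ?y (1 + 1 + t)"
      by (simp add: computes_in_def main_fn_def)
    have "length V \<le> val_size x" "length es \<le> val_size x"
      using length_less_val_size[of "map (enc_vertex I) us"] length_less_val_size[of "map (enc_vertex I) vs"]
        length_less_val_size[of "map (enc_edge I) es"] by (simp_all add: x)
    from time_le[OF this] t(2) have time: "1 + 1 + t \<le> poly (time_poly K c) (val_size x)"
      by linarith
    have enc: "encodes_solution ?y I ?p (set hs)"
      unfolding encodes_solution_def
      by (rule exI[of _ V], rule exI[of _ hs], rule exI[of _ "price_from I hs"])
        (use us vs hs I in \<open>auto simp: selection_def pricing_instance_def\<close>)
    note price = price_properties[OF F]
    have nn: "0 \<le> gain I (real_budget I) (set hs)"
      using F I by (intro gain_nonneg) (auto simp: within_capacity_def pricing_instance_def)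
    have "opt_revenue I \<le> (2 - 1 / real C + 1 / (real C * real (Suc \<rho>))) * gain I (real_budget I) (set hs)
        + opt_revenue I / real c"
      using local_optimum[OF hs opt F] C(1)
      by (intro opt_le_of_local_optimum[OF F]) (auto simp: K_def c_def)
    also have "\<dots> \<le> (\<alpha> - \<epsilon> / 2) * gain I (real_budget I) (set hs) + opt_revenue I * (\<epsilon> / 2 / \<alpha>)"
    proof (rule add_mono)
      have "0 \<le> opt_revenue I"
        using revenue_le_opt_revenue[OF I(1) price(1)] nn price(2) by simp
      then have "opt_revenue I * inverse (real c) \<le> opt_revenue I * (\<epsilon> / 2 / \<alpha>)"
        using c' by (intro mult_left_mono) (auto simp: c_def)
      then show "opt_revenue I / real c \<le> opt_revenue I * (\<epsilon> / 2 / \<alpha>)"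
        by (simp only: divide_inverse)
    qed (intro mult_right_mono a nn)
    \<comment> \<open>As \<open>1 - \<epsilon> / 2 / \<alpha> = (\<alpha> - \<epsilon> / 2) /
      \<alpha>\<close>, both sides share the positive factor
      \<open>\<alpha> - \<epsilon> / 2\<close>; the share of rounding was taken relative to \<alpha>
      for this cancellation.\<close>
    finally have "opt_revenue I * ((\<alpha> - \<epsilon> / 2) / \<alpha>) \<le> (\<alpha> - \<epsilon> / 2) * gain I (real_budget I) (set hs)"
      using \<alpha>1 by (simp add: field_simps)
    then have "(\<alpha> - \<epsilon> / 2) * (inverse \<alpha> * opt_revenue I) \<le> (\<alpha> - \<epsilon> / 2) * gain I (real_budget I) (set hs)"
      by (simp only: divide_inverse ac_simps)
    then have "inverse \<alpha> * opt_revenue I \<le> gain I (real_budget I) (set hs)"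
      using pos by (simp only: mult_le_cancel_left_pos)
    then have "revenue I ?p (set hs) \<ge> inverse \<alpha> * opt_revenue I"
      using price(2) by simp
    with comp time enc price(1) show ?thesis by blast
  qed
  then have "polytime_approximation (pricing_program K c) \<alpha>
      {I. pricing_instance I \<and> (\<forall>v\<in>lefts I. capacity I v \<le> enat C)}"
    unfolding polytime_approximation_def by blast
  then show ?thesis unfolding \<alpha>_def by blast
qed

end
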